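(* Let $(X,d)$ be a metric space. Then the functors $CN(X)\otimes_{\boldsymbol{[0,\infty)}} A_{[0,-]}\colon \boldsymbol{[0,\infty)}\to \mathrm{ch}_{\mathrm{Ab}}$ and $CN(X)\colon \boldsymbol{[0,\infty)}\to \mathrm{ch}_{\mathrm{Ab}}$ are (naturally) isomorphic. In particular, the blurred magnitude homology of $X$, i.e. the homology of $CN(X)\otimes_{\boldsymbol{[0,\infty)}} A_{[0,-]}$, is isomorphic to the persistent homology of $X$ with respect to the enriched nerve, i.e. to $H_\star(CN(X))$, as functors on $\boldsymbol{[0,\infty)}$.
   Context: Let $\boldsymbol{[0,\infty)}$ be the category whose objects are the non-negative real numbers, with exactly one morphism $\epsilon\to\epsilon'$ whenever $\epsilon\le\epsilon'$ (and no others). $\mathrm{Ab}$ is the category of abelian groups, $\mathrm{ch}_{\mathrm{Ab}}$ the category of chain complexes of abelian groups, $\boxtimes$ the tensor product of abelian groups and the induced tensor product of chain complexes. Abelian groups are regarded as chain complexes concentrated in degree $0$. Enriched nerve: $N(X)\colon \boldsymbol{[0,\infty)}\to \mathrm{sSet}$ sends $\epsilon$ to the simplicial set with $n$-simplices $$N(X)(\epsilon)_n=\Big\{(x_0,\dots,x_n)\ \Big|\ x_i\in X,\ \sum_{i=0}^{n-1} d(x_i,x_{i+1})\le\epsilon\Big\},$$ where the $i$th face map deletes the entry $x_i$ and the $i$th degeneracy map repeats the entry $x_i$; morphisms $\epsilon\le\epsilon'$ are sent to the inclusions. $CN(X)\colon \boldsymbol{[0,\infty)}\to \mathrm{ch}_{\mathrm{Ab}}$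 is the composite of $N(X)$ with the free abelian group functor $\mathbb{Z}[\cdot]\colon \mathrm{sSet}\to \mathrm{sAb}$ (simplicial abelian groups) and the unnormalised chain complex functor $\mathrm{sAb}\to \mathrm{ch}_{\mathrm{Ab}}$ (boundary map equal to the alternating sum of the face maps). Coends: for a functor $A\colon \boldsymbol{[0,\infty)}^{\mathrm{op}}\to \mathrm{Ab}\hookrightarrow \mathrm{ch}_{\mathrm{Ab}}$, the chain complex $CN(X)\otimes_{\boldsymbol{[0,\infty)}}A$ is the coend of $CN(X)\boxtimes A$, that is, the coequaliser of the two maps $$\bigoplus_{\ell\le\ell'} CN(X)(\ell)\boxtimes A(\ell')\rightrightarrows \bigoplus_{\ell\in[0,\infty)} CN(X)(\ell)\boxtimes A(\ell)$$ induced by $CN(X)(\ell\le\ell')\boxtimes 1$ (landing in the summand $\ell'$) and $1\boxtimes A(\ell\le\ell')$ (landing in the summand $\ell$). Coefficient functors: for $\epsilon\in[0,\infty]$, $A_{[0,\epsilon]}\colon \boldsymbol{[0,\infty)}^{\mathrm{op}}\to \mathrm{Ab}$ sends $\ell$ to $\mathbb{Z}$ if $\ell\in[0,\epsilon]$ and to $0$ otherwise, and sends $\ell\ge\ell'$ to $\mathrm{id}_{\mathbb{Z}}$ if $\ell,\ell'\in[0,\epsilon]$ and to $0$ otherwise. For $\epsilon\le\epsilon'$ the natural transformation $A_{[0,\epsilon]}\Rightarrow A_{[0,\epsilon']}$ whose component at $\ell$ is the identity if $\ell\in[0,\epsilon]$ and zero otherwise induces a chain map $CN(X)\otimes_{\boldsymbol{[0,\infty)}}A_{[0,\epsilon]}\to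 CN(X)\otimes_{\boldsymbol{[0,\infty)}}A_{[0,\epsilon']}$; this defines the functor $CN(X)\otimes_{\boldsymbol{[0,\infty)}}A_{[0,-]}\colon \boldsymbol{[0,\infty)}\to \mathrm{ch}_{\mathrm{Ab}}$, $\epsilon\mapsto CN(X)\otimes_{\boldsymbol{[0,\infty)}}A_{[0,\epsilon]}$. The blurred magnitude homology of $X$ is the homology of the functor $CN(X)\otimes_{\boldsymbol{[0,\infty)}}A_{[0,-]}$ (i.e. its composite with the homology functor $H_\star$). The persistent homology of $X$ with respect to the enriched nerve is the composite $H_\star(CN(X))$ (coefficients in the unit for $\boxtimes$). *)

theory Defs
  imports
    "HOL-Analysis.Abstract_Metric_Spaces"
    "HOL-Algebra.Free_Abelian_Groups"
    "HOL-Algebra.Elementary_Groups"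
    "HOL-Algebra.Generated_Groups"
    "HOL-Library.Extended_Real"
begin

section \<open>Diagrams indexed by the poset of non-negative reals\<close>

text \<open>
  A (covariant or contravariant) functor on the poset category of non-negative reals is given by
  its values on objects and its values on the unique morphism \<open>e \<rightarrow> e'\<close> for \<open>e \<le> e'\<close>.
  Values outside \<open>0 \<le> e \<le> e'\<close> are irrelevant. For a contravariant functor \<open>A\<close>, the map
  \<open>Ar A e e'\<close> goes from \<open>Ob A e'\<close> to \<open>Ob A e\<close>.
\<close>

record ('o, 'm) diagram =
  Ob :: "real \<Rightarrow> 'o"
  Ar :: "real \<Rightarrow> real \<Rightarrow> 'm"

subsection \<open>Functors to abelian groups\<close>

text \<open>Homomorphisms are compared on carriers only, as usual in \<open>HOL-Algebra\<close>.\<close>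

definition ab_functor :: "('g monoid, 'g \<Rightarrow> 'g) diagram \<Rightarrow> bool" where
  "ab_functor F \<longleftrightarrow>
     (\<forall>e\<ge>0. comm_group (Ob F e)) \<and>
     (\<forall>e\<ge>0. \<forall>e'\<ge>e. Ar F e e' \<in> hom (Ob F e) (Ob F e')) \<and>
     (\<forall>e\<ge>0. \<forall>x\<in>carrier (Ob F e). Ar F e e x = x) \<and>
     (\<forall>e\<ge>0. \<forall>e'\<ge>e. \<forall>e''\<ge>e'. \<forall>x\<in>carrier (Ob F e).
        Ar F e' e'' (Ar F e e' x) = Ar F e e'' x)"

definition ab_naturally_isomorphic ::
    "('g monoid, 'g \<Rightarrow> 'g) diagram \<Rightarrow> ('h monoid, 'h \<Rightarrow> 'h) diagram \<Rightarrow> bool" where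
  "ab_naturally_isomorphic F G \<longleftrightarrow>
     ab_functor F \<and> ab_functor G \<and>
     (\<exists>\<eta>. (\<forall>e\<ge>0. \<eta> e \<in> iso (Ob F e) (Ob G e)) \<and>
          (\<forall>e\<ge>0. \<forall>e'\<ge>e. \<forall>x\<in>carrier (Ob F e).
             \<eta> e' (Ar F e e' x) = Ar G e e' (\<eta> e x)))"

section \<open>Chain complexes of abelian groups\<close>

text \<open>Complexes are graded over the integers; \<open>bd C n\<close> goes from degree \<open>n\<close> to degree \<open>n - 1\<close>.\<close>

record 'g ch =
  grp :: "int \<Rightarrow> 'g monoid"
  bd :: "int \<Rightarrow> 'g \<Rightarrow> 'g"

definition is_chain_complex :: "'g ch \<Rightarrow> bool" where
  "is_chain_complex C \<longleftrightarrow>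
     (\<forall>n. comm_group (grp C n)) \<and>
     (\<forall>n. bd C n \<in> hom (grp C n) (grp C (n - 1))) \<and>
     (\<forall>n. \<forall>x\<in>carrier (grp C n). bd C (n - 1) (bd C n x) = \<one>\<^bsub>grp C (n - 2)\<^esub>)"

definition is_chain_map :: "'g ch \<Rightarrow> 'h ch \<Rightarrow> (int \<Rightarrow> 'g \<Rightarrow> 'h) \<Rightarrow> bool" where
  "is_chain_map C D f \<longleftrightarrow>
     (\<forall>n. f n \<in> hom (grp C n) (grp D n)) \<and>
     (\<forall>n. \<forall>x\<in>carrier (grp C n). f (n - 1) (bd C n x) = bd D n (f n x))"

definition is_chain_iso :: "'g ch \<Rightarrow> 'h ch \<Rightarrow> (int \<Rightarrow> 'g \<Rightarrow> 'h) \<Rightarrow> bool" where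
  "is_chain_iso C D f \<longleftrightarrow>
     is_chain_map C D f \<and> (\<forall>n. f n \<in> iso (grp C n) (grp D n))"

definition ch_functor :: "('g ch, int \<Rightarrow> 'g \<Rightarrow> 'g) diagram \<Rightarrow> bool" where
  "ch_functor F \<longleftrightarrow>
     (\<forall>e\<ge>0. is_chain_complex (Ob F e)) \<and>
     (\<forall>e\<ge>0. \<forall>e'\<ge>e. is_chain_map (Ob F e) (Ob F e') (Ar F e e')) \<and>
     (\<forall>e\<ge>0. \<forall>n. \<forall>x\<in>carrier (grp (Ob F e) n). Ar F e e n x = x) \<and>
     (\<forall>e\<ge>0. \<forall>e'\<ge>e. \<forall>e''\<ge>e'. \<forall>n. \<forall>x\<in>carrier (grp (Ob F e) n).
        Ar F e' e'' n (Ar F e e' n x) = Ar F e e'' n x)"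

definition ch_naturally_isomorphic ::
    "('g ch, int \<Rightarrow> 'g \<Rightarrow> 'g) diagram \<Rightarrow> ('h ch, int \<Rightarrow> 'h \<Rightarrow> 'h) diagram \<Rightarrow> bool" where
  "ch_naturally_isomorphic F G \<longleftrightarrow>
     ch_functor F \<and> ch_functor G \<and>
     (\<exists>\<eta>. (\<forall>e\<ge>0. is_chain_iso (Ob F e) (Ob G e) (\<eta> e)) \<and>
          (\<forall>e\<ge>0. \<forall>e'\<ge>e. \<forall>n. \<forall>x\<in>carrier (grp (Ob F e) n).
             \<eta> e' n (Ar F e e' n x) = Ar G e e' n (\<eta> e n x)))"

text \<open>
  The map induced on quotients by \<open>f\<close>: a coset of the source subgroup is sent to the coset of
  \<open>N\<close> in \<open>K\<close> that contains its image under \<open>f\<close>.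
\<close>

definition quot_map :: "'h monoid \<Rightarrow> 'h set \<Rightarrow> ('g \<Rightarrow> 'h) \<Rightarrow> 'g set \<Rightarrow> 'h set" where
  "quot_map K N f S = N <#>\<^bsub>K\<^esub> (f ` S)"

subsection \<open>Homology\<close>

definition cycles :: "'g ch \<Rightarrow> int \<Rightarrow> 'g monoid" where
  "cycles C n = subgroup_generated (grp C n) (kernel (grp C n) (grp C (n - 1)) (bd C n))"

definition boundaries :: "'g ch \<Rightarrow> int \<Rightarrow> 'g set" where
  "boundaries C n = bd C (n + 1) ` carrier (grp C (n + 1))"

definition homology :: "int \<Rightarrow> 'g ch \<Rightarrow> 'g set monoid" where
  "homology n C = cycles C n Mod boundaries C n"

definition homology_map :: "int \<Rightarrow> 'h ch \<Rightarrow> (int \<Rightarrow> 'g \<Rightarrow> 'h) \<Rightarrow> 'g set \<Rightarrow> 'h set" where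
  "homology_map n D f = quot_map (cycles D n) (boundaries D n) (f n)"

definition homology_functor ::
    "int \<Rightarrow> ('g ch, int \<Rightarrow> 'g \<Rightarrow> 'g) diagram \<Rightarrow> ('g set monoid, 'g set \<Rightarrow> 'g set) diagram" where
  "homology_functor n F =
     \<lparr>Ob = (\<lambda>e. homology n (Ob F e)),
      Ar = (\<lambda>e e'. homology_map n (Ob F e') (Ar F e e'))\<rparr>"

subsection \<open>Abelian groups as complexes concentrated in degree zero\<close>

definition conc0 :: "'g monoid \<Rightarrow> 'g ch" where
  "conc0 A = \<lparr>grp = (\<lambda>n. if n = 0 then A else singleton_group \<one>\<^bsub>A\<^esub>), bd = (\<lambda>n x. \<one>\<^bsub>A\<^esub>)\<rparr>"

definition conc0_map :: "'h monoid \<Rightarrow> ('g \<Rightarrow> 'h) \<Rightarrow> int \<Rightarrow> 'g \<Rightarrow> 'h" where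
  "conc0_map B f n = (if n = 0 then f else (\<lambda>x. \<one>\<^bsub>B\<^esub>))"

section \<open>Tensor products\<close>

subsection \<open>Tensor product of abelian groups\<close>

text \<open>
  The free abelian group on pairs (written additively, \<open>frag_of (x, y)\<close> being the generator
  belonging to \<open>(x, y)\<close>) modulo the subgroup generated by the bilinearity relations.
\<close>

definition tensor_free :: "'g monoid \<Rightarrow> 'h monoid \<Rightarrow> ('g \<times> 'h \<Rightarrow>\<^sub>0 int) monoid" where
  "tensor_free G H = free_Abelian_group (carrier G \<times> carrier H)"

definition tensor_rels :: "'g monoid \<Rightarrow> 'h monoid \<Rightarrow> ('g \<times> 'h \<Rightarrow>\<^sub>0 int) set" where
  "tensor_rels G H = generate (tensor_free G H)
     ({frag_of (x \<otimes>\<^bsub>G\<^esub> x', y) - frag_of (x, y) - frag_of (x', y) | x x' y.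
         x \<in> carrier G \<and> x' \<in> carrier G \<and> y \<in> carrier H} \<union>
      {frag_of (x, y \<otimes>\<^bsub>H\<^esub> y') - frag_of (x, y) - frag_of (x, y') | x y y'.
         x \<in> carrier G \<and> y \<in> carrier H \<and> y' \<in> carrier H})"

definition tensor :: "'g monoid \<Rightarrow> 'h monoid \<Rightarrow> ('g \<times> 'h \<Rightarrow>\<^sub>0 int) set monoid" where
  "tensor G H = tensor_free G H Mod tensor_rels G H"

text \<open>\<open>tensor_map G' H' f g\<close> is the tensor product of \<open>f : G \<rightarrow> G'\<close> and \<open>g : H \<rightarrow> H'\<close>.\<close>

definition tensor_map ::
    "'g2 monoid \<Rightarrow> 'h2 monoid \<Rightarrow> ('g \<Rightarrow> 'g2) \<Rightarrow> ('h \<Rightarrow> 'h2) \<Rightarrow>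
     ('g \<times> 'h \<Rightarrow>\<^sub>0 int) set \<Rightarrow> ('g2 \<times> 'h2 \<Rightarrow>\<^sub>0 int) set" where
  "tensor_map G' H' f g =
     quot_map (tensor_free G' H') (tensor_rels G' H') (frag_extend (\<lambda>(x, y). frag_of (f x, g y)))"

subsection \<open>Tensor product of chain complexes\<close>

text \<open>
  In degree \<open>n\<close> this is the direct sum over all \<open>p\<close> of the tensor product of \<open>C\<close> in degree \<open>p\<close>
  with \<open>D\<close> in degree \<open>n - p\<close>; the differential sends \<open>c \<otimes> c'\<close>, with \<open>c\<close> of degree \<open>p\<close>, to
  \<open>\<partial>c \<otimes> c' + (-1)\<^sup>p (c \<otimes> \<partial>c')\<close>. Below, the summand \<open>p\<close> of the differential of \<open>z\<close> receives the
  first term from the summand \<open>p + 1\<close> of \<open>z\<close> and the second one from the summand \<open>p\<close>.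
\<close>

definition ch_tensor :: "'g ch \<Rightarrow> 'h ch \<Rightarrow> (int \<Rightarrow> ('g \<times> 'h \<Rightarrow>\<^sub>0 int) set) ch" where
  "ch_tensor C D =
     \<lparr>grp = (\<lambda>n. sum_group UNIV (\<lambda>p. tensor (grp C p) (grp D (n - p)))),
      bd = (\<lambda>n z p.
        let T = tensor (grp C p) (grp D (n - 1 - p)) in
        tensor_map (grp C p) (grp D (n - 1 - p)) (bd C (p + 1)) (\<lambda>y. y) (z (p + 1))
        \<otimes>\<^bsub>T\<^esub>
        (tensor_map (grp C p) (grp D (n - 1 - p)) (\<lambda>x. x) (bd D (n - p)) (z p))
           [^]\<^bsub>T\<^esub> (if even p then 1 else - 1 :: int))\<rparr>"

definition ch_tensor_map ::
    "'g2 ch \<Rightarrow> 'h2 ch \<Rightarrow> (int \<Rightarrow> 'g \<Rightarrow> 'g2) \<Rightarrow> (int \<Rightarrow> 'h \<Rightarrow> 'h2) \<Rightarrow>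
     int \<Rightarrow> (int \<Rightarrow> ('g \<times> 'h \<Rightarrow>\<^sub>0 int) set) \<Rightarrow> (int \<Rightarrow> ('g2 \<times> 'h2 \<Rightarrow>\<^sub>0 int) set)" where
  "ch_tensor_map C' D' f g n z =
     (\<lambda>p. tensor_map (grp C' p) (grp D' (n - p)) (f p) (g (n - p)) (z p))"

section \<open>Direct sums and coequalisers of chain complexes\<close>

definition ch_sum :: "'i set \<Rightarrow> ('i \<Rightarrow> 'g ch) \<Rightarrow> ('i \<Rightarrow> 'g) ch" where
  "ch_sum I C =
     \<lparr>grp = (\<lambda>n. sum_group I (\<lambda>i. grp (C i) n)),
      bd = (\<lambda>n z. \<lambda>i\<in>I. bd (C i) n (z i))\<rparr>"

definition ch_sum_incl :: "'i set \<Rightarrow> ('i \<Rightarrow> 'g ch) \<Rightarrow> 'i \<Rightarrow> int \<Rightarrow> 'g \<Rightarrow> ('i \<Rightarrow> 'g)" where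
  "ch_sum_incl I C i n x = (\<lambda>j\<in>I. if j = i then x else \<one>\<^bsub>grp (C j) n\<^esub>)"

text \<open>The map out of a direct sum with components \<open>f i\<close>; the product has finite support.\<close>

definition ch_sum_desc ::
    "'i set \<Rightarrow> 'h ch \<Rightarrow> ('i \<Rightarrow> int \<Rightarrow> 'g \<Rightarrow> 'h) \<Rightarrow> int \<Rightarrow> ('i \<Rightarrow> 'g) \<Rightarrow> 'h" where
  "ch_sum_desc I D f n z = gfinprod (grp D n) (\<lambda>i. f i n (z i)) I"

definition ch_sum_map ::
    "'i set \<Rightarrow> ('i \<Rightarrow> int \<Rightarrow> 'g \<Rightarrow> 'h) \<Rightarrow> int \<Rightarrow> ('i \<Rightarrow> 'g) \<Rightarrow> ('i \<Rightarrow> 'h)" where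
  "ch_sum_map I f n z = (\<lambda>i\<in>I. f i n (z i))"

definition coeq_rels ::
    "'g ch \<Rightarrow> 'h ch \<Rightarrow> (int \<Rightarrow> 'g \<Rightarrow> 'h) \<Rightarrow> (int \<Rightarrow> 'g \<Rightarrow> 'h) \<Rightarrow> int \<Rightarrow> 'h set" where
  "coeq_rels C D f g n =
     (\<lambda>x. f n x \<otimes>\<^bsub>grp D n\<^esub> inv\<^bsub>grp D n\<^esub> g n x) ` carrier (grp C n)"

definition ch_coeq ::
    "'g ch \<Rightarrow> 'h ch \<Rightarrow> (int \<Rightarrow> 'g \<Rightarrow> 'h) \<Rightarrow> (int \<Rightarrow> 'g \<Rightarrow> 'h) \<Rightarrow> 'h set ch" where
  "ch_coeq C D f g =
     \<lparr>grp = (\<lambda>n. grp D n Mod coeq_rels C D f g n),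
      bd = (\<lambda>n. quot_map (grp D (n - 1)) (coeq_rels C D f g (n - 1)) (bd D n))\<rparr>"

section \<open>Coends\<close>

text \<open>
  Throughout, \<open>F\<close> is a covariant functor to chain complexes and \<open>A\<close> a contravariant functor to
  abelian groups.
\<close>

definition coend_index :: "(real \<times> real) set" where
  "coend_index = {(l, l'). 0 \<le> l \<and> l \<le> l'}"

definition coend_summand ::
    "('g ch, int \<Rightarrow> 'g \<Rightarrow> 'g) diagram \<Rightarrow> ('h monoid, 'h \<Rightarrow> 'h) diagram \<Rightarrow> real \<Rightarrow> real \<Rightarrow>
     (int \<Rightarrow> ('g \<times> 'h \<Rightarrow>\<^sub>0 int) set) ch" where
  "coend_summand F A l l' = ch_tensor (Ob F l) (conc0 (Ob A l'))"

definition coend_source ::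
    "('g ch, int \<Rightarrow> 'g \<Rightarrow> 'g) diagram \<Rightarrow> ('h monoid, 'h \<Rightarrow> 'h) diagram \<Rightarrow>
     (real \<times> real \<Rightarrow> int \<Rightarrow> ('g \<times> 'h \<Rightarrow>\<^sub>0 int) set) ch" where
  "coend_source F A = ch_sum coend_index (\<lambda>(l, l'). coend_summand F A l l')"

definition coend_target ::
    "('g ch, int \<Rightarrow> 'g \<Rightarrow> 'g) diagram \<Rightarrow> ('h monoid, 'h \<Rightarrow> 'h) diagram \<Rightarrow>
     (real \<Rightarrow> int \<Rightarrow> ('g \<times> 'h \<Rightarrow>\<^sub>0 int) set) ch" where
  "coend_target F A = ch_sum {0..} (\<lambda>l. coend_summand F A l l)"

definition coend_cov ::
    "('g ch, int \<Rightarrow> 'g \<Rightarrow> 'g) diagram \<Rightarrow> ('h monoid, 'h \<Rightarrow> 'h) diagram \<Rightarrow> int \<Rightarrow>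
     (real \<times> real \<Rightarrow> int \<Rightarrow> ('g \<times> 'h \<Rightarrow>\<^sub>0 int) set) \<Rightarrow>
     (real \<Rightarrow> int \<Rightarrow> ('g \<times> 'h \<Rightarrow>\<^sub>0 int) set)" where
  "coend_cov F A =
     ch_sum_desc coend_index (coend_target F A)
       (\<lambda>(l, l') n z.
          ch_sum_incl {0..} (\<lambda>m. coend_summand F A m m) l' n
            (ch_tensor_map (Ob F l') (conc0 (Ob A l')) (Ar F l l') (\<lambda>_ y. y) n z))"

definition coend_contra ::
    "('g ch, int \<Rightarrow> 'g \<Rightarrow> 'g) diagram \<Rightarrow> ('h monoid, 'h \<Rightarrow> 'h) diagram \<Rightarrow> int \<Rightarrow>
     (real \<times> real \<Rightarrow> int \<Rightarrow> ('g \<times> 'h \<Rightarrow>\<^sub>0 int) set) \<Rightarrow>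
     (real \<Rightarrow> int \<Rightarrow> ('g \<times> 'h \<Rightarrow>\<^sub>0 int) set)" where
  "coend_contra F A =
     ch_sum_desc coend_index (coend_target F A)
       (\<lambda>(l, l') n z.
          ch_sum_incl {0..} (\<lambda>m. coend_summand F A m m) l n
            (ch_tensor_map (Ob F l) (conc0 (Ob A l)) (\<lambda>_ x. x)
               (conc0_map (Ob A l) (Ar A l l')) n z))"

definition coend ::
    "('g ch, int \<Rightarrow> 'g \<Rightarrow> 'g) diagram \<Rightarrow> ('h monoid, 'h \<Rightarrow> 'h) diagram \<Rightarrow>
     (real \<Rightarrow> int \<Rightarrow> ('g \<times> 'h \<Rightarrow>\<^sub>0 int) set) set ch" where
  "coend F A =
     ch_coeq (coend_source F A) (coend_target F A) (coend_cov F A) (coend_contra F A)"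

text \<open>The chain map \<open>coend F A \<rightarrow> coend F B\<close> induced by a natural transformation \<open>\<tau> : A \<Rightarrow> B\<close>.\<close>

definition coend_map ::
    "('g ch, int \<Rightarrow> 'g \<Rightarrow> 'g) diagram \<Rightarrow> ('h monoid, 'h \<Rightarrow> 'h) diagram \<Rightarrow> (real \<Rightarrow> 'h \<Rightarrow> 'h) \<Rightarrow>
     int \<Rightarrow> (real \<Rightarrow> int \<Rightarrow> ('g \<times> 'h \<Rightarrow>\<^sub>0 int) set) set \<Rightarrow>
     (real \<Rightarrow> int \<Rightarrow> ('g \<times> 'h \<Rightarrow>\<^sub>0 int) set) set" where
  "coend_map F B \<tau> n =
     quot_map (grp (coend_target F B) n)
       (coeq_rels (coend_source F B) (coend_target F B) (coend_cov F B) (coend_contra F B) n)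
       (ch_sum_map {0..}
          (\<lambda>l. ch_tensor_map (Ob F l) (conc0 (Ob B l)) (\<lambda>_ x. x) (conc0_map (Ob B l) (\<tau> l))) n)"

section \<open>The enriched nerve and its chain complex\<close>

text \<open>
  In a simplicial set \<open>S\<close>, \<open>face S n i\<close> and \<open>degen S n i\<close> are the \<open>i\<close>-th face and degeneracy map
  defined on \<open>n\<close>-simplices, for \<open>i \<le> n\<close> (and \<open>n > 0\<close> for faces). Similarly for simplicial abelian
  groups.
\<close>

record 'a sset =
  simp :: "nat \<Rightarrow> 'a set"
  face :: "nat \<Rightarrow> nat \<Rightarrow> 'a \<Rightarrow> 'a"
  degen :: "nat \<Rightarrow> nat \<Rightarrow> 'a \<Rightarrow> 'a"

record 'g sab =
  sgrp :: "nat \<Rightarrow> 'g monoid"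
  sface :: "nat \<Rightarrow> nat \<Rightarrow> 'g \<Rightarrow> 'g"
  sdegen :: "nat \<Rightarrow> nat \<Rightarrow> 'g \<Rightarrow> 'g"

text \<open>Simplices \<open>(x\<^sub>0, \<dots>, x\<^sub>n)\<close> are represented as lists of length \<open>n + 1\<close>.\<close>

definition nerve_at :: "'x set \<Rightarrow> ('x \<Rightarrow> 'x \<Rightarrow> real) \<Rightarrow> real \<Rightarrow> 'x list sset" where
  "nerve_at X d e =
     \<lparr>simp = (\<lambda>n. {xs. length xs = Suc n \<and> set xs \<subseteq> X \<and>
                       (\<Sum>i<n. d (xs ! i) (xs ! Suc i)) \<le> e}),
      face = (\<lambda>n i xs. take i xs @ drop (Suc i) xs),
      degen = (\<lambda>n i xs. take (Suc i) xs @ drop i xs)\<rparr>"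

definition enriched_nerve ::
    "'x set \<Rightarrow> ('x \<Rightarrow> 'x \<Rightarrow> real) \<Rightarrow> ('x list sset, nat \<Rightarrow> 'x list \<Rightarrow> 'x list) diagram" where
  "enriched_nerve X d = \<lparr>Ob = nerve_at X d, Ar = (\<lambda>e e' n x. x)\<rparr>"

definition free_sab :: "'a sset \<Rightarrow> ('a \<Rightarrow>\<^sub>0 int) sab" where
  "free_sab S =
     \<lparr>sgrp = (\<lambda>n. free_Abelian_group (simp S n)),
      sface = (\<lambda>n i. frag_extend (frag_of \<circ> face S n i)),
      sdegen = (\<lambda>n i. frag_extend (frag_of \<circ> degen S n i))\<rparr>"

definition free_sab_map :: "(nat \<Rightarrow> 'a \<Rightarrow> 'b) \<Rightarrow> nat \<Rightarrow> ('a \<Rightarrow>\<^sub>0 int) \<Rightarrow> ('b \<Rightarrow>\<^sub>0 int)" where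
  "free_sab_map f n = frag_extend (frag_of \<circ> f n)"

definition unnormalised :: "'g sab \<Rightarrow> 'g ch" where
  "unnormalised S =
     \<lparr>grp = (\<lambda>n. if n \<ge> 0 then sgrp S (nat n) else singleton_group \<one>\<^bsub>sgrp S 0\<^esub>),
      bd = (\<lambda>n x.
        if n > 0 then
          finprod (sgrp S (nat n - 1))
            (\<lambda>i. sface S (nat n) i x [^]\<^bsub>sgrp S (nat n - 1)\<^esub> ((- 1) ^ i :: int)) {..nat n}
        else \<one>\<^bsub>sgrp S 0\<^esub>)\<rparr>"

definition unnormalised_map :: "'h sab \<Rightarrow> (nat \<Rightarrow> 'g \<Rightarrow> 'h) \<Rightarrow> int \<Rightarrow> 'g \<Rightarrow> 'h" where
  "unnormalised_map T f n = (if n \<ge> 0 then f (nat n) else (\<lambda>x. \<one>\<^bsub>sgrp T 0\<^esub>))"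

definition CN ::
    "'x set \<Rightarrow> ('x \<Rightarrow> 'x \<Rightarrow> real) \<Rightarrow>
     (('x list \<Rightarrow>\<^sub>0 int) ch, int \<Rightarrow> ('x list \<Rightarrow>\<^sub>0 int) \<Rightarrow> ('x list \<Rightarrow>\<^sub>0 int)) diagram" where
  "CN X d =
     \<lparr>Ob = (\<lambda>e. unnormalised (free_sab (Ob (enriched_nerve X d) e))),
      Ar = (\<lambda>e e'. unnormalised_map (free_sab (Ob (enriched_nerve X d) e'))
                     (free_sab_map (Ar (enriched_nerve X d) e e')))\<rparr>"

section \<open>Blurred magnitude homology and persistent homology\<close>

definition coeff :: "ereal \<Rightarrow> (int monoid, int \<Rightarrow> int) diagram" where
  "coeff \<epsilon> =
     \<lparr>Ob = (\<lambda>l. if 0 \<le> l \<and> ereal l \<le> \<epsilon> then integer_group else singleton_group 0),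
      Ar = (\<lambda>l l' k. if 0 \<le> l \<and> ereal l \<le> \<epsilon> \<and> 0 \<le> l' \<and> ereal l' \<le> \<epsilon> then k else 0)\<rparr>"

definition coeff_trans :: "ereal \<Rightarrow> real \<Rightarrow> int \<Rightarrow> int" where
  "coeff_trans \<epsilon> l k = (if 0 \<le> l \<and> ereal l \<le> \<epsilon> then k else 0)"

definition CN_coend ::
    "'x set \<Rightarrow> ('x \<Rightarrow> 'x \<Rightarrow> real) \<Rightarrow>
     ((real \<Rightarrow> int \<Rightarrow> (('x list \<Rightarrow>\<^sub>0 int) \<times> int \<Rightarrow>\<^sub>0 int) set) set ch,
      int \<Rightarrow> (real \<Rightarrow> int \<Rightarrow> (('x list \<Rightarrow>\<^sub>0 int) \<times> int \<Rightarrow>\<^sub>0 int) set) set \<Rightarrow>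
             (real \<Rightarrow> int \<Rightarrow> (('x list \<Rightarrow>\<^sub>0 int) \<times> int \<Rightarrow>\<^sub>0 int) set) set) diagram" where
  "CN_coend X d =
     \<lparr>Ob = (\<lambda>e. coend (CN X d) (coeff (ereal e))),
      Ar = (\<lambda>e e'. coend_map (CN X d) (coeff (ereal e')) (coeff_trans (ereal e)))\<rparr>"

definition blurred_magnitude_homology where
  "blurred_magnitude_homology X d n = homology_functor n (CN_coend X d)"

definition persistent_homology where
  "persistent_homology X d n = homology_functor n (CN X d)"

end

theory Submission
  imports Defs
begin

text \<open>
  The statement is an instance of the co-Yoneda lemma. The coefficient functor \<open>A\<close> belonging to
  \<open>[0, \<epsilon>]\<close> takes the value \<open>\<int>\<close> at \<open>l\<close> if there is a morphism \<open>l \<rightarrow> \<epsilon>\<close> and the value \<open>0\<close>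
  otherwise, so \<open>A\<close> is the free abelian group on the functor represented by \<open>\<epsilon>\<close>. For every functor
  \<open>F\<close> to chain complexes the coend of \<open>F\<close> with such an \<open>A\<close> is therefore \<open>F \<epsilon>\<close>. The metric enters
  through the fact that \<open>CN X d\<close> is a functor to chain complexes: by the triangle inequality, deleting
  an entry does not increase the length of a tuple, so that the face maps exist.

  Concretely, with abelian groups written multiplicatively, in degree \<open>n\<close> the direct sum of the
  \<open>F l \<otimes> A l\<close> is mapped to \<open>F \<epsilon>\<close> by \<open>x \<otimes> k \<mapsto> F (l \<le> \<epsilon>) x\<^sup>k\<close> (lemma \<open>eval_target_gen\<close>). This homomorphism has the section
  \<open>y \<mapsto> y \<otimes> 1\<close> at the index \<open>\<epsilon>\<close>, hence is onto. The coend relations are killed because \<open>F\<close> is a functor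
  (\<open>eval_cov_contra\<close>). Conversely, a generator \<open>x \<otimes> k\<close> at \<open>l \<le> \<epsilon>\<close> is moved to
  \<open>F (l \<le> \<epsilon>) x \<otimes> k = F (l \<le> \<epsilon>) x\<^sup>k \<otimes> 1\<close> at \<open>\<epsilon>\<close> by the single coend relation indexed by \<open>l \<le> \<epsilon>\<close>, and
  it vanishes for \<open>l > \<epsilon>\<close>; so every element agrees modulo the relations with the section applied to its image
  (\<open>coset_eval\<close>), and the kernel is exactly the group of relations (\<open>kernel_eval\<close>). The first
  isomorphism theorem gives the isomorphism. It commutes with boundaries and with the maps induced by
  \<open>\<epsilon> \<le> \<epsilon>'\<close>, and since it is bijective this also transports the functor laws from \<open>F\<close> to the coend
  (\<open>ch_naturally_isomorphic_transport\<close>). The claim about homology follows because homology turns natural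
  isomorphisms into natural isomorphisms.

  All the groups in sight are iterated quotients and direct sums, whose elements are awkward to
  handle. Therefore each of them is shown to be generated by the images of pure tensors, every map
  is shown to be a homomorphism with a simple value on these, and identities between maps are
  checked on generators only (\<open>hom_eq_on_generators\<close>).
\<close>

section \<open>Maps between quotients, and homomorphisms on generators\<close>

text \<open>
  The common step for homomorphisms (\<open>quot_map_coset\<close>) and for functions that are compatible with
  kernels (\<open>quot_map_kernel\<close>): once the image of a coset lies in a single target coset, multiplying
  it by the subgroup fills that coset.
\<close>

lemma quot_map_eq_coset:
  assumes "group K" "subgroup N K" "y \<in> carrier K" "S \<noteq> {}" "f ` S \<subseteq> N #>\<^bsub>K\<^esub> y"
  shows "quot_map K N f S = N #>\<^bsub>K\<^esub> y"
proof -
  interpret group K by fact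
  have eq: "N #>\<^bsub>K\<^esub> t = N #>\<^bsub>K\<^esub> y" if "t \<in> f ` S" for t
    using repr_independence[of t N y] assms that by auto
  have "quot_map K N f S = (\<Union>t\<in>f ` S. N #>\<^bsub>K\<^esub> t)"
    by (auto simp: quot_map_def set_mult_def r_coset_def)
  also have "\<dots> = N #>\<^bsub>K\<^esub> y"
    using eq assms(4) by auto
  finally show ?thesis .
qed

lemma quot_map_coset:
  assumes G: "group G" and N: "subgroup N G" and K: "group K" and M: "subgroup M K"
    and f: "f \<in> hom G K" "f ` N \<subseteq> M" and x: "x \<in> carrier G"
  shows "quot_map K M f (N #>\<^bsub>G\<^esub> x) = M #>\<^bsub>K\<^esub> f x"
proof (rule quot_map_eq_coset[OF K M])
  show "f x \<in> carrier K" using f x by (auto simp: hom_def)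
  show "N #>\<^bsub>G\<^esub> x \<noteq> {}" using subgroup.one_closed[OF N] by (auto simp: r_coset_def)
  show "f ` (N #>\<^bsub>G\<^esub> x) \<subseteq> M #>\<^bsub>K\<^esub> f x"
  proof
    fix t assume "t \<in> f ` (N #>\<^bsub>G\<^esub> x)"
    then obtain n where n: "n \<in> N" "t = f (n \<otimes>\<^bsub>G\<^esub> x)" by (auto simp: r_coset_def)
    then have "t = f n \<otimes>\<^bsub>K\<^esub> f x"
      using f x subgroup.mem_carrier[OF N n(1)] by (simp add: hom_mult)
    then show "t \<in> M #>\<^bsub>K\<^esub> f x" using f n by (auto simp: r_coset_def)
  qed
qed

lemma quot_map_hom:
  assumes N: "N \<lhd> G" and M: "M \<lhd> K" and f: "f \<in> hom G K" "f ` N \<subseteq> M"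
  shows "quot_map K M f \<in> hom (G Mod N) (K Mod M)"
proof -
  interpret N: normal N G by fact
  interpret M: normal M K by fact
  have c: "quot_map K M f (N #>\<^bsub>G\<^esub> x) = M #>\<^bsub>K\<^esub> f x" if "x \<in> carrier G" for x
    using quot_map_coset[OF N.is_group N.subgroup_axioms M.is_group M.subgroup_axioms f that] .
  have fc: "f x \<in> carrier K" if "x \<in> carrier G" for x using f that by (auto simp: hom_def)
  show ?thesis
  proof (rule homI)
    fix X assume "X \<in> carrier (G Mod N)"
    then show "quot_map K M f X \<in> carrier (K Mod M)"
      using c fc by (auto simp: carrier_FactGroup)
  next
    fix X Y assume "X \<in> carrier (G Mod N)" "Y \<in> carrier (G Mod N)"
    then obtain x y where "x \<in> carrier G" "X = N #>\<^bsub>G\<^esub> x" "y \<in> carrier G" "Y = N #>\<^bsub>G\<^esub> y"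
      by (auto simp: carrier_FactGroup)
    then show "quot_map K M f (X \<otimes>\<^bsub>G Mod N\<^esub> Y) =
        quot_map K M f X \<otimes>\<^bsub>K Mod M\<^esub> quot_map K M f Y"
      using f by (simp add: N.rcos_sum M.rcos_sum c fc hom_mult)
  qed
qed

lemma (in group_hom) mem_kernel_coset:
  assumes "x \<in> carrier G" "y \<in> carrier G" "h x = h y"
  shows "x \<in> kernel G H h #> y"
  using FactGroup_subset[OF assms] G.rcos_self[OF assms(1) subgroup_kernel] by blast

lemma (in group_hom) the_elem_image_kernel_coset:
  assumes "x \<in> carrier G"
  shows "the_elem (h ` (kernel G H h #> x)) = h x"
proof -
  have "h ` (kernel G H h #> x) = {h x}"
    using G.rcos_self[OF assms subgroup_kernel] assms by (auto simp: r_coset_def kernel_def)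
  then show ?thesis by simp
qed

text \<open>
  When both subgroups are kernels, the quotients embed into \<open>H\<close> and \<open>L\<close>, so a map \<open>f\<close> that lies
  over some \<open>u : H \<rightarrow> L\<close> descends to the quotients and becomes \<open>u\<close> there.
\<close>

lemma quot_map_kernel:
  assumes h: "group_hom G H h" and k: "group_hom K L k"
    and f: "\<And>x. x \<in> carrier G \<Longrightarrow> f x \<in> carrier K"
    and comm: "\<And>x. x \<in> carrier G \<Longrightarrow> k (f x) = u (h x)"
    and S: "S \<in> carrier (G Mod kernel G H h)"
  shows "quot_map K (kernel K L k) f S \<in> carrier (K Mod kernel K L k)"
    and "the_elem (k ` quot_map K (kernel K L k) f S) = u (the_elem (h ` S))"
proof -
  interpret h: group_hom G H h by fact
  interpret k: group_hom K L k by fact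
  obtain x where x: "x \<in> carrier G" "S = kernel G H h #>\<^bsub>G\<^esub> x"
    using S by (auto simp: carrier_FactGroup)
  have eq: "quot_map K (kernel K L k) f S = kernel K L k #>\<^bsub>K\<^esub> f x"
  proof (rule quot_map_eq_coset[OF k.G.is_group k.subgroup_kernel f[OF x(1)]])
    show "S \<noteq> {}" using h.G.rcos_self[OF x(1) h.subgroup_kernel] x(2) by auto
    show "f ` S \<subseteq> kernel K L k #>\<^bsub>K\<^esub> f x"
    proof (rule image_subsetI)
      fix s assume "s \<in> S"
      then have s: "s \<in> carrier G" "h s = h x"
        using x by (auto simp: r_coset_def kernel_def)
      show "f s \<in> kernel K L k #>\<^bsub>K\<^esub> f x"
        by (rule k.mem_kernel_coset) (use s x f comm in auto)
    qed
  qed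
  show "quot_map K (kernel K L k) f S \<in> carrier (K Mod kernel K L k)"
    unfolding eq carrier_FactGroup using f[OF x(1)] by blast
  show "the_elem (k ` quot_map K (kernel K L k) f S) = u (the_elem (h ` S))"
    unfolding eq unfolding x(2)
    by (simp add: x(1) f k.the_elem_image_kernel_coset h.the_elem_image_kernel_coset comm)
qed

lemma hom_eq_on_generators:
  assumes "group G" "group H" "f \<in> hom G H" "g \<in> hom G H"
    and gen: "carrier G = generate G S"
    and eq: "\<And>s. s \<in> S \<Longrightarrow> f s = g s"
    and x: "x \<in> carrier G"
  shows "f x = g x"
proof -
  interpret f: group_hom G H f using assms by (simp add: group_hom_def group_hom_axioms_def)
  interpret g: group_hom G H g using assms by (simp add: group_hom_def group_hom_axioms_def)
  have mem: "y \<in> carrier G" if "y \<in> generate G S" for y using gen that by simp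
  have "x \<in> generate G S" using x gen by simp
  then show ?thesis
  proof induction
    case (inv s)
    then have "s \<in> carrier G" using gen generate.incl by metis
    then show ?case using inv eq by simp
  next
    case (eng y z)
    then show ?case using mem by simp
  qed (auto simp: eq)
qed

lemma generated_subset_subgroup:
  assumes "carrier G = generate G S" "group G" "subgroup H G" "S \<subseteq> H"
  shows "carrier G \<subseteq> H"
  using group.generate_subgroup_incl[OF assms(2,4,3)] assms(1) by simp

lemma hom_cong_on:
  assumes "f \<in> hom G H" "group G" "\<And>x. x \<in> carrier G \<Longrightarrow> g x = f x"
  shows "g \<in> hom G H"
  using assms by (simp add: hom_def Pi_iff group.is_monoid monoid.m_closed)

section \<open>Direct sums of groups\<close>

definition sum_incl :: "'i set \<Rightarrow> ('i \<Rightarrow> 'g monoid) \<Rightarrow> 'i \<Rightarrow> 'g \<Rightarrow> 'i \<Rightarrow> 'g" where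
  "sum_incl I G i x = (\<lambda>j\<in>I. if j = i then x else \<one>\<^bsub>G j\<^esub>)"

lemma sum_incl_hom:
  assumes G: "\<And>i. i \<in> I \<Longrightarrow> group (G i)" and i: "i \<in> I"
  shows "sum_incl I G i \<in> hom (G i) (sum_group I G)"
proof (rule homI)
  fix x assume x: "x \<in> carrier (G i)"
  have "finite {j \<in> I. (if j = i then x else \<one>\<^bsub>G j\<^esub>) \<noteq> \<one>\<^bsub>G j\<^esub>}"
    by (rule finite_subset[of _ "{i}"]) auto
  then show "sum_incl I G i x \<in> carrier (sum_group I G)"
    using x G by (auto simp: carrier_sum_group sum_incl_def group.is_monoid monoid.one_closed cong: conj_cong)
next
  fix x y assume "x \<in> carrier (G i)" "y \<in> carrier (G i)"
  then show "sum_incl I G i (x \<otimes>\<^bsub>G i\<^esub> y) = sum_incl I G i x \<otimes>\<^bsub>sum_group I G\<^esub> sum_incl I G i y"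
    using G by (fastforce simp: sum_incl_def group.is_monoid monoid.one_closed)
qed

lemma comm_group_sum_group:
  assumes "\<And>i. i \<in> I \<Longrightarrow> comm_group (G i)"
  shows "comm_group (sum_group I G)"
proof (rule group.group_comm_groupI)
  have g: "group (G i)" if "i \<in> I" for i using assms[OF that] by (simp add: comm_group_def)
  then show "group (sum_group I G)" by simp
  fix x y assume "x \<in> carrier (sum_group I G)" "y \<in> carrier (sum_group I G)"
  then show "x \<otimes>\<^bsub>sum_group I G\<^esub> y = y \<otimes>\<^bsub>sum_group I G\<^esub> x"
    using assms g
    by (auto simp: carrier_sum_group PiE_iff comm_group_def intro!: restrict_ext comm_monoid.m_comm)
qed

text \<open>
  Elements of the direct sum have finite support, so they are finite products of elements that are
  concentrated at one index; the proof splits off one index of the support at a time.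
\<close>

lemma sum_group_generated:
  assumes G: "\<And>i. i \<in> I \<Longrightarrow> group (G i)"
    and gen: "\<And>i. i \<in> I \<Longrightarrow> carrier (G i) = generate (G i) (S i)"
  shows "carrier (sum_group I G) = generate (sum_group I G) (\<Union>i\<in>I. sum_incl I G i ` S i)"
    (is "_ = generate ?P ?T")
proof -
  interpret P: group ?P using G by simp
  have T: "?T \<subseteq> carrier ?P"
  proof (rule UN_least, rule image_subsetI)
    fix i s assume "i \<in> I" "s \<in> S i"
    moreover from this have "s \<in> carrier (G i)" using gen by (simp add: generate.incl)
    ultimately show "sum_incl I G i s \<in> carrier ?P"
      by (auto intro!: hom_in_carrier[OF sum_incl_hom[of I G i, OF G]])
  qed
  let ?H = "generate ?P ?T"
  have sub: "subgroup ?H ?P" by (rule P.generate_is_subgroup[OF T])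
  have incl: "sum_incl I G i x \<in> ?H" if i: "i \<in> I" and x: "x \<in> carrier (G i)" for i x
  proof -
    interpret h: group_hom "G i" ?P "sum_incl I G i"
      using G i sum_incl_hom[of I G i] by (simp add: group_hom_def group_hom_axioms_def)
    have mem: "y \<in> carrier (G i)" if "y \<in> generate (G i) (S i)" for y using gen i that by simp
    have "x \<in> generate (G i) (S i)" using gen i x by simp
    then show ?thesis
    proof induction
      case one show ?case by (simp only: h.hom_one generate.one)
    next
      case (incl s) then show ?case using i by (intro generate.incl) auto
    next
      case (inv s)
      have "s \<in> carrier (G i)" using inv mem generate.incl by metis
      then show ?case using inv i by (simp only: h.hom_inv) (intro generate.inv, auto)
    next
      case (eng y z)
      then have "sum_incl I G i (y \<otimes>\<^bsub>G i\<^esub> z) = sum_incl I G i y \<otimes>\<^bsub>?P\<^esub> sum_incl I G i z"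
        using mem by (intro h.hom_mult)
      then show ?case using eng generate.eng by metis
    qed
  qed
  \<comment> \<open>Induction over a finite set that contains the support.\<close>
  have "\<forall>z\<in>carrier ?P. {i\<in>I. z i \<noteq> \<one>\<^bsub>G i\<^esub>} \<subseteq> A \<longrightarrow> z \<in> ?H" if "finite A" for A
    using that
  proof induction
    case empty
    show ?case
    proof (intro ballI impI)
      fix z assume "z \<in> carrier ?P" "{i\<in>I. z i \<noteq> \<one>\<^bsub>G i\<^esub>} \<subseteq> {}"
      then have "z = \<one>\<^bsub>?P\<^esub>" using G by (auto simp: carrier_sum_group PiE_iff extensional_def fun_eq_iff)
      then show "z \<in> ?H" using generate.one by metis
    qed
  next
    case (insert i A)
    show ?case
    proof (intro ballI impI)
      fix z assume z: "z \<in> carrier ?P" and supp: "{j\<in>I. z j \<noteq> \<one>\<^bsub>G j\<^esub>} \<subseteq> insert i A"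
      show "z \<in> ?H"
      proof (cases "i \<in> I")
        case True
        define w where "w = z(i := \<one>\<^bsub>G i\<^esub>)"
        have zc: "\<And>j. j \<in> I \<Longrightarrow> z j \<in> carrier (G j)" using z G by (auto simp: carrier_sum_group)
        have "finite {j \<in> I. w j \<noteq> \<one>\<^bsub>G j\<^esub>}"
          by (rule finite_subset[of _ "{j \<in> I. z j \<noteq> \<one>\<^bsub>G j\<^esub>}"])
             (use z G in \<open>auto simp: w_def carrier_sum_group\<close>)
        then have wc: "w \<in> carrier ?P"
          using z True G by (auto simp: w_def carrier_sum_group PiE_iff extensional_def group.is_monoid monoid.one_closed)
        moreover have "{j\<in>I. w j \<noteq> \<one>\<^bsub>G j\<^esub>} \<subseteq> A" using supp by (auto simp: w_def)
        ultimately have "w \<in> ?H" using insert.IH by blast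
        moreover have "z = sum_incl I G i (z i) \<otimes>\<^bsub>?P\<^esub> w"
        proof
          fix j show "z j = (sum_incl I G i (z i) \<otimes>\<^bsub>?P\<^esub> w) j"
            using z zc G True
            by (auto simp: w_def sum_incl_def carrier_sum_group extensional_def PiE_iff
                group.is_monoid monoid.l_one monoid.r_one)
        qed
        ultimately show ?thesis
          using incl[OF True zc[OF True]] generate.eng by metis
      next
        case False
        then have "{j\<in>I. z j \<noteq> \<one>\<^bsub>G j\<^esub>} \<subseteq> A" using supp by auto
        then show ?thesis using insert.IH z by blast
      qed
    qed
  qed
  moreover have "finite {i\<in>I. z i \<noteq> \<one>\<^bsub>G i\<^esub>}" if "z \<in> carrier ?P" for z
    using that G by (simp add: carrier_sum_group)
  ultimately have "carrier ?P \<subseteq> ?H" by blast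
  then show ?thesis using subgroup.subset[OF sub] by blast
qed

lemma sum_group_map_hom:
  assumes G: "\<And>i. i \<in> I \<Longrightarrow> group (G i)" and H: "\<And>i. i \<in> I \<Longrightarrow> group (H i)"
    and f: "\<And>i. i \<in> I \<Longrightarrow> f i \<in> hom (G i) (H i)"
  shows "(\<lambda>z. \<lambda>i\<in>I. f i (z i)) \<in> hom (sum_group I G) (sum_group I H)"
proof (rule homI)
  fix z assume z: "z \<in> carrier (sum_group I G)"
  have "finite {i\<in>I. f i (z i) \<noteq> \<one>\<^bsub>H i\<^esub>}"
    by (rule finite_subset[of _ "{i\<in>I. z i \<noteq> \<one>\<^bsub>G i\<^esub>}"])
       (use z G H f in \<open>auto simp: carrier_sum_group hom_one\<close>)
  then show "(\<lambda>i\<in>I. f i (z i)) \<in> carrier (sum_group I H)"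
    using z G H f by (auto simp: carrier_sum_group PiE_iff hom_def Pi_iff cong: conj_cong)
next
  fix z w assume "z \<in> carrier (sum_group I G)" "w \<in> carrier (sum_group I G)"
  then show "(\<lambda>i\<in>I. f i ((z \<otimes>\<^bsub>sum_group I G\<^esub> w) i)) =
      (\<lambda>i\<in>I. f i (z i)) \<otimes>\<^bsub>sum_group I H\<^esub> (\<lambda>i\<in>I. f i (w i))"
    using G f by (auto simp: carrier_sum_group PiE_iff hom_mult intro!: restrict_ext)
qed

lemma sum_group_map_incl:
  assumes "\<And>i. i \<in> I \<Longrightarrow> group (G i)" "\<And>i. i \<in> I \<Longrightarrow> group (H i)"
    and "\<And>i. i \<in> I \<Longrightarrow> f i \<in> hom (G i) (H i)"
  shows "(\<lambda>j\<in>I. f j (sum_incl I G i x j)) = sum_incl I H i (f i x)"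
  using assms by (auto simp: sum_incl_def hom_one intro!: restrict_ext)

lemma gfinprod_incl:
  assumes "comm_group K" and G: "\<And>i. i \<in> I \<Longrightarrow> group (G i)"
    and f: "\<And>i. i \<in> I \<Longrightarrow> f i \<in> hom (G i) K" and i: "i \<in> I" and x: "x \<in> carrier (G i)"
  shows "gfinprod K (\<lambda>j. f j (sum_incl I G i x j)) I = f i x"
proof -
  interpret comm_group K by fact
  have fx: "f i x \<in> carrier K" using f i x by (auto simp: hom_def)
  have one: "f j \<one>\<^bsub>G j\<^esub> = \<one>\<^bsub>K\<^esub>" if "j \<in> I" for j
    using hom_one[OF f[OF that] G[OF that] is_group] .
  have "gfinprod K (\<lambda>j. f j (sum_incl I G i x j)) I = gfinprod K (\<lambda>j. f i x) {i}"
    by (rule gfinprod_mono_neutral_cong_right) (use i fx one in \<open>auto simp: sum_incl_def\<close>)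
  also have "\<dots> = f i x" using fx by (simp add: finprod_singleton)
  finally show ?thesis .
qed

section \<open>Tensor products of abelian groups\<close>

lemma tensor_rels_subgroup:
  assumes "group G" "group H"
  shows "subgroup (tensor_rels G H) (tensor_free G H)"
proof -
  interpret G: group G by fact
  interpret H: group H by fact
  interpret T: group "tensor_free G H" by (simp add: tensor_free_def)
  have *: "frag_of a - frag_of b - frag_of c \<in> carrier (tensor_free G H)"
    if "a \<in> carrier G \<times> carrier H" "b \<in> carrier G \<times> carrier H" "c \<in> carrier G \<times> carrier H" for a b c
    using that keys_diff[of "frag_of a - frag_of b" "frag_of c"] keys_diff[of "frag_of a" "frag_of b"]
    by (auto simp: tensor_free_def)
  show ?thesis
    unfolding tensor_rels_def
    by (rule T.generate_is_subgroup) (auto intro!: *)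
qed

lemma comm_group_tensor_free: "comm_group (tensor_free G H)"
  by (simp add: tensor_free_def abelian_free_Abelian_group)

lemma tensor_rels_normal:
  assumes "group G" "group H"
  shows "tensor_rels G H \<lhd> tensor_free G H"
  using comm_group.subgroup_imp_normal[OF comm_group_tensor_free tensor_rels_subgroup[OF assms]] .

lemma comm_group_tensor:
  assumes "group G" "group H"
  shows "comm_group (tensor G H)"
  unfolding tensor_def
  using comm_group.abelian_FactGroup[OF comm_group_tensor_free tensor_rels_subgroup[OF assms]] .

lemma group_tensor:
  assumes "group G" "group H"
  shows "group (tensor G H)"
  using comm_group_tensor[OF assms] by (simp add: comm_group_def)

definition tens :: "'g monoid \<Rightarrow> 'h monoid \<Rightarrow> 'g \<Rightarrow> 'h \<Rightarrow> ('g \<times> 'h \<Rightarrow>\<^sub>0 int) set" where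
  "tens G H x y = tensor_rels G H #>\<^bsub>tensor_free G H\<^esub> frag_of (x, y)"

lemma tens_closed: "x \<in> carrier G \<Longrightarrow> y \<in> carrier H \<Longrightarrow> tens G H x y \<in> carrier (tensor G H)"
  by (auto simp: tens_def tensor_def carrier_FactGroup tensor_free_def intro!: imageI)

lemma tensor_coset_eqI:
  assumes "group G" "group H" "a \<in> carrier (tensor_free G H)" "b \<in> carrier (tensor_free G H)"
    and "a - b \<in> tensor_rels G H"
  shows "tensor_rels G H #>\<^bsub>tensor_free G H\<^esub> a = tensor_rels G H #>\<^bsub>tensor_free G H\<^esub> b"
proof -
  interpret T: group "tensor_free G H" by (simp add: tensor_free_def)
  have "a \<in> tensor_rels G H #>\<^bsub>tensor_free G H\<^esub> b"
    using assms(5) by (force simp: r_coset_def tensor_free_def)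
  then show ?thesis
    using T.repr_independence[OF _ assms(4) tensor_rels_subgroup[OF assms(1,2)]] by blast
qed

lemma tens_add_left:
  assumes "group G" "group H" "x \<in> carrier G" "x' \<in> carrier G" "y \<in> carrier H"
  shows "tens G H (x \<otimes>\<^bsub>G\<^esub> x') y = tens G H x y \<otimes>\<^bsub>tensor G H\<^esub> tens G H x' y"
proof -
  interpret N: normal "tensor_rels G H" "tensor_free G H" by (rule tensor_rels_normal[OF assms(1,2)])
  interpret G: group G by fact
  have fc: "frag_of (u, y) \<in> carrier (tensor_free G H)" if "u \<in> carrier G" for u
    using that assms by (simp add: tensor_free_def)
  have "tens G H (x \<otimes>\<^bsub>G\<^esub> x') y
      = tensor_rels G H #>\<^bsub>tensor_free G H\<^esub> (frag_of (x, y) \<otimes>\<^bsub>tensor_free G H\<^esub> frag_of (x', y))"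
    unfolding tens_def
  proof (rule tensor_coset_eqI[OF assms(1,2)])
    have "frag_of (x \<otimes>\<^bsub>G\<^esub> x', y) - frag_of (x, y) - frag_of (x', y) \<in> tensor_rels G H"
      unfolding tensor_rels_def by (rule generate.incl) (use assms in blast)
    then show "frag_of (x \<otimes>\<^bsub>G\<^esub> x', y) - frag_of (x, y) \<otimes>\<^bsub>tensor_free G H\<^esub> frag_of (x', y) \<in> tensor_rels G H"
      by (simp add: tensor_free_def diff_diff_eq)
  qed (intro fc N.m_closed assms G.m_closed)+
  also have "\<dots> = tens G H x y \<otimes>\<^bsub>tensor G H\<^esub> tens G H x' y"
    using assms fc by (simp add: tens_def tensor_def N.rcos_sum)
  finally show ?thesis .
qed

lemma tens_add_right:
  assumes "group G" "group H" "x \<in> carrier G" "y \<in> carrier H" "y' \<in> carrier H"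
  shows "tens G H x (y \<otimes>\<^bsub>H\<^esub> y') = tens G H x y \<otimes>\<^bsub>tensor G H\<^esub> tens G H x y'"
proof -
  interpret N: normal "tensor_rels G H" "tensor_free G H" by (rule tensor_rels_normal[OF assms(1,2)])
  interpret H: group H by fact
  have fc: "frag_of (x, u) \<in> carrier (tensor_free G H)" if "u \<in> carrier H" for u
    using that assms by (simp add: tensor_free_def)
  have "tens G H x (y \<otimes>\<^bsub>H\<^esub> y')
      = tensor_rels G H #>\<^bsub>tensor_free G H\<^esub> (frag_of (x, y) \<otimes>\<^bsub>tensor_free G H\<^esub> frag_of (x, y'))"
    unfolding tens_def
  proof (rule tensor_coset_eqI[OF assms(1,2)])
    have "frag_of (x, y \<otimes>\<^bsub>H\<^esub> y') - frag_of (x, y) - frag_of (x, y') \<in> tensor_rels G H"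
      unfolding tensor_rels_def by (rule generate.incl) (use assms in blast)
    then show "frag_of (x, y \<otimes>\<^bsub>H\<^esub> y') - frag_of (x, y) \<otimes>\<^bsub>tensor_free G H\<^esub> frag_of (x, y') \<in> tensor_rels G H"
      by (simp add: tensor_free_def diff_diff_eq)
  qed (intro fc N.m_closed assms H.m_closed)+
  also have "\<dots> = tens G H x y \<otimes>\<^bsub>tensor G H\<^esub> tens G H x y'"
    using assms fc by (simp add: tens_def tensor_def N.rcos_sum)
  finally show ?thesis .
qed

lemma tens_hom_left:
  assumes "group G" "group H" "y \<in> carrier H"
  shows "(\<lambda>x. tens G H x y) \<in> hom G (tensor G H)"
  using assms by (auto intro!: homI simp: tens_closed tens_add_left)

lemma tens_hom_right:
  assumes "group G" "group H" "x \<in> carrier G"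
  shows "tens G H x \<in> hom H (tensor G H)"
  using assms by (auto intro!: homI simp: tens_closed tens_add_right)

lemma tens_one_right:
  assumes "group G" "group H" "x \<in> carrier G"
  shows "tens G H x \<one>\<^bsub>H\<^esub> = \<one>\<^bsub>tensor G H\<^esub>"
  using hom_one[OF tens_hom_right[OF assms] assms(2) group_tensor[OF assms(1,2)]] .

text \<open>
  The free abelian group is generated by the pairs, and the quotient map carries this over.
\<close>

lemma tensor_generated:
  assumes "group G" "group H"
  shows "carrier (tensor G H) = generate (tensor G H) {tens G H x y | x y. x \<in> carrier G \<and> y \<in> carrier H}"
    (is "_ = generate _ ?T")
proof -
  interpret N: normal "tensor_rels G H" "tensor_free G H" by (rule tensor_rels_normal[OF assms])
  interpret T: group "tensor G H" by (rule group_tensor[OF assms])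
  let ?q = "\<lambda>a. tensor_rels G H #>\<^bsub>tensor_free G H\<^esub> a"
  interpret q: group_hom "tensor_free G H" "tensor G H" ?q
    using N.r_coset_hom_Mod T.is_group N.is_group by (simp add: group_hom_def group_hom_axioms_def tensor_def)
  have sub: "?T \<subseteq> carrier (tensor G H)" by (auto intro: tens_closed)
  have S: "subgroup (generate (tensor G H) ?T) (tensor G H)" by (rule T.generate_is_subgroup[OF sub])
  have "?q a \<in> generate (tensor G H) ?T" if "Poly_Mapping.keys a \<subseteq> carrier G \<times> carrier H" for a
  proof (rule free_Abelian_group_induct[OF that])
    have "?q 0 = \<one>\<^bsub>tensor G H\<^esub>" using q.hom_one by (simp add: tensor_free_def)
    then show "?q 0 \<in> generate (tensor G H) ?T" using generate.one by metis
  next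
    fix x y
    assume xy: "Poly_Mapping.keys x \<subseteq> carrier G \<times> carrier H"
      "Poly_Mapping.keys y \<subseteq> carrier G \<times> carrier H"
      and IH: "?q x \<in> generate (tensor G H) ?T" "?q y \<in> generate (tensor G H) ?T"
    then have c: "x \<in> carrier (tensor_free G H)" "y \<in> carrier (tensor_free G H)"
      by (simp_all add: tensor_free_def)
    have "x - y = x \<otimes>\<^bsub>tensor_free G H\<^esub> inv\<^bsub>tensor_free G H\<^esub> y"
      using xy by (simp add: tensor_free_def)
    then have "?q (x - y) = ?q x \<otimes>\<^bsub>tensor G H\<^esub> inv\<^bsub>tensor G H\<^esub> ?q y"
      using c by (simp only: q.hom_mult q.hom_inv N.inv_closed)
    then show "?q (x - y) \<in> generate (tensor G H) ?T"
      by (simp only: IH subgroup.m_closed[OF S] subgroup.m_inv_closed[OF S])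
  next
    fix a assume "a \<in> carrier G \<times> carrier H"
    then show "?q (frag_of a) \<in> generate (tensor G H) ?T"
      by (intro generate.incl) (auto simp: tens_def)
  qed
  then have "carrier (tensor G H) \<subseteq> generate (tensor G H) ?T"
    by (auto simp: tensor_def carrier_FactGroup tensor_free_def)
  then show ?thesis using subgroup.subset[OF S] by blast
qed

text \<open>
  The common core of the universal property of the tensor product and of its functoriality:
  bilinearity is exactly the vanishing of \<open>h\<close> on the generating relations, and the kernel of \<open>h\<close> is
  a subgroup.
\<close>

lemma hom_kills_tensor_rels:
  assumes "group G" "group H" and K: "group K"
    and h: "h \<in> hom (tensor_free G H) K" "\<And>x y. x \<in> carrier G \<Longrightarrow> y \<in> carrier H \<Longrightarrow> h (frag_of (x, y)) = b x y"
    and l: "\<And>y. y \<in> carrier H \<Longrightarrow> (\<lambda>x. b x y) \<in> hom G K"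
    and r: "\<And>x. x \<in> carrier G \<Longrightarrow> b x \<in> hom H K"
    and a: "a \<in> tensor_rels G H"
  shows "h a = \<one>\<^bsub>K\<^esub>"
proof -
  interpret G: group G by fact
  interpret H: group H by fact
  interpret h: group_hom "tensor_free G H" K h
    using K h(1) by (simp add: group_hom_def group_hom_axioms_def tensor_free_def)
  have bc: "b x y \<in> carrier K" if "x \<in> carrier G" "y \<in> carrier H" for x y
    using r that by (auto simp: hom_def)
  have rel: "h (frag_of p - frag_of q - frag_of s) = \<one>\<^bsub>K\<^esub>"
    if "p \<in> carrier G \<times> carrier H" "q \<in> carrier G \<times> carrier H" "s \<in> carrier G \<times> carrier H"
      and eq: "h (frag_of p) = h (frag_of s) \<otimes>\<^bsub>K\<^esub> h (frag_of q)" for p q s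
  proof -
    have c: "frag_of p \<in> carrier (tensor_free G H)" "frag_of q \<in> carrier (tensor_free G H)"
        "frag_of s \<in> carrier (tensor_free G H)"
      using that by (auto simp: tensor_free_def)
    have k: "Poly_Mapping.keys (frag_of p - frag_of q) \<subseteq> carrier G \<times> carrier H"
      using that keys_diff[of "frag_of p" "frag_of q"] by auto
    have "frag_of p - frag_of q - frag_of s = (frag_of p \<otimes>\<^bsub>tensor_free G H\<^esub> inv\<^bsub>tensor_free G H\<^esub> frag_of q)
        \<otimes>\<^bsub>tensor_free G H\<^esub> inv\<^bsub>tensor_free G H\<^esub> frag_of s"
      using that k by (simp add: tensor_free_def)
    then show ?thesis
      using c eq by (simp add: h.H.m_assoc)
  qed
  interpret B: comm_group "tensor_free G H" by (rule comm_group_tensor_free)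
  let ?R1 = "{frag_of (x \<otimes>\<^bsub>G\<^esub> x', y) - frag_of (x, y) - frag_of (x', y) | x x' y.
       x \<in> carrier G \<and> x' \<in> carrier G \<and> y \<in> carrier H}"
  let ?R2 = "{frag_of (x, y \<otimes>\<^bsub>H\<^esub> y') - frag_of (x, y) - frag_of (x, y') | x y y'.
       x \<in> carrier G \<and> y \<in> carrier H \<and> y' \<in> carrier H}"
  have comm: "h u \<otimes>\<^bsub>K\<^esub> h v = h v \<otimes>\<^bsub>K\<^esub> h u" if "u \<in> carrier (tensor_free G H)" "v \<in> carrier (tensor_free G H)" for u v
    using that by (metis B.m_comm h.hom_mult)
  have R1: "?R1 \<subseteq> kernel (tensor_free G H) K h"
  proof
    fix a assume "a \<in> ?R1"
    then obtain x x' y where a: "a = frag_of (x \<otimes>\<^bsub>G\<^esub> x', y) - frag_of (x, y) - frag_of (x', y)"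
      and c: "x \<in> carrier G" "x' \<in> carrier G" "y \<in> carrier H" by blast
    have "h (frag_of (x \<otimes>\<^bsub>G\<^esub> x', y)) = h (frag_of (x', y)) \<otimes>\<^bsub>K\<^esub> h (frag_of (x, y))"
      using c comm[of "frag_of (x, y)" "frag_of (x', y)"] hom_mult[OF l[of y], of x x']
      by (simp add: h(2) tensor_free_def)
    moreover have "a \<in> carrier (tensor_free G H)"
      using c keys_diff[of "frag_of (x \<otimes>\<^bsub>G\<^esub> x', y) - frag_of (x, y)" "frag_of (x', y)"]
        keys_diff[of "frag_of (x \<otimes>\<^bsub>G\<^esub> x', y)" "frag_of (x, y)"] by (auto simp: a tensor_free_def)
    ultimately show "a \<in> kernel (tensor_free G H) K h"
      using rel c by (auto simp: kernel_def a)
  qed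
  have R2: "?R2 \<subseteq> kernel (tensor_free G H) K h"
  proof
    fix a assume "a \<in> ?R2"
    then obtain x y y' where a: "a = frag_of (x, y \<otimes>\<^bsub>H\<^esub> y') - frag_of (x, y) - frag_of (x, y')"
      and c: "x \<in> carrier G" "y \<in> carrier H" "y' \<in> carrier H" by blast
    have "h (frag_of (x, y \<otimes>\<^bsub>H\<^esub> y')) = h (frag_of (x, y')) \<otimes>\<^bsub>K\<^esub> h (frag_of (x, y))"
      using c comm[of "frag_of (x, y)" "frag_of (x, y')"] hom_mult[OF r[of x], of y y']
      by (simp add: h(2) tensor_free_def)
    moreover have "a \<in> carrier (tensor_free G H)"
      using c keys_diff[of "frag_of (x, y \<otimes>\<^bsub>H\<^esub> y') - frag_of (x, y)" "frag_of (x, y')"]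
        keys_diff[of "frag_of (x, y \<otimes>\<^bsub>H\<^esub> y')" "frag_of (x, y)"] by (auto simp: a tensor_free_def)
    ultimately show "a \<in> kernel (tensor_free G H) K h"
      using rel c by (auto simp: kernel_def a)
  qed
  have "tensor_rels G H \<subseteq> kernel (tensor_free G H) K h"
    unfolding tensor_rels_def
    by (rule h.G.generate_subgroup_incl[OF Un_least[OF R1 R2] h.subgroup_kernel])
  then show ?thesis using a by (auto simp: kernel_def)
qed

lemma tensor_universal:
  assumes "group G" "group H" and K: "comm_group K"
    and l: "\<And>y. y \<in> carrier H \<Longrightarrow> (\<lambda>x. b x y) \<in> hom G K"
    and r: "\<And>x. x \<in> carrier G \<Longrightarrow> b x \<in> hom H K"
  shows "\<exists>t \<in> hom (tensor G H) K. \<forall>x\<in>carrier G. \<forall>y\<in>carrier H. t (tens G H x y) = b x y"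
proof -
  interpret K: comm_group K by fact
  have img: "(\<lambda>(x, y). b x y) ` (carrier G \<times> carrier H) \<subseteq> carrier K"
    using r by (auto simp: hom_def)
  obtain h where h: "h \<in> hom (free_Abelian_group (carrier G \<times> carrier H)) K"
    "\<And>p. p \<in> carrier G \<times> carrier H \<Longrightarrow> h (frag_of p) = (\<lambda>(x, y). b x y) p"
    using K.free_Abelian_group_universal[OF img] by blast
  have h': "h \<in> hom (tensor_free G H) K" using h by (simp add: tensor_free_def)
  have kills: "h a = \<one>\<^bsub>K\<^esub>" if "a \<in> tensor_rels G H" for a
    by (rule hom_kills_tensor_rels[OF assms(1,2) K.is_group h' _ l r that]) (use h(2) in auto)
  interpret h: group_hom "tensor_free G H" K h
    using K.is_group h' by (simp add: group_hom_def group_hom_axioms_def tensor_free_def)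
  have N: "tensor_rels G H \<lhd> tensor_free G H" by (rule tensor_rels_normal[OF assms(1,2)])
  have "tensor_rels G H \<subseteq> kernel (tensor_free G H) K h"
    using kills subgroup.mem_carrier[OF normal_imp_subgroup[OF N]] by (auto simp: kernel_def)
  then obtain g where g: "g \<in> hom (tensor_free G H Mod tensor_rels G H) K"
    "\<And>x. x \<in> carrier (tensor_free G H) \<Longrightarrow> g (tensor_rels G H #>\<^bsub>tensor_free G H\<^esub> x) = h x"
    using h.FactGroup_universal_kernel[OF N] by blast
  show ?thesis
  proof (intro bexI ballI)
    show "g \<in> hom (tensor G H) K" using g(1) by (simp add: tensor_def)
    fix x y assume "x \<in> carrier G" "y \<in> carrier H"
    then show "g (tens G H x y) = b x y"
      using g(2)[of "frag_of (x, y)"] h(2)[of "(x, y)"] by (simp add: tens_def tensor_free_def)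
  qed
qed

lemma
  assumes G: "group G" "group H" and G': "group G'" "group H'"
    and f: "f \<in> hom G G'" and g: "g \<in> hom H H'"
  shows tensor_map_hom: "tensor_map G' H' f g \<in> hom (tensor G H) (tensor G' H')"
    and tensor_map_tens: "\<And>x y. x \<in> carrier G \<Longrightarrow> y \<in> carrier H \<Longrightarrow>
          tensor_map G' H' f g (tens G H x y) = tens G' H' (f x) (g y)"
proof -
  let ?e = "frag_extend (\<lambda>(x, y). frag_of (f x, g y))"
  have fc: "f x \<in> carrier G'" if "x \<in> carrier G" for x using f that by (auto simp: hom_def)
  have gc: "g y \<in> carrier H'" if "y \<in> carrier H" for y using g that by (auto simp: hom_def)
  have e: "?e \<in> hom (tensor_free G H) (tensor_free G' H')"
  proof (rule homI)
    fix a assume "a \<in> carrier (tensor_free G H)"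
    then show "?e a \<in> carrier (tensor_free G' H')"
      using keys_frag_extend[of "\<lambda>(x, y). frag_of (f x, g y)" a] fc gc
      by (fastforce simp: tensor_free_def)
  qed (simp add: tensor_free_def frag_extend_add)
  have N: "tensor_rels G H \<lhd> tensor_free G H" and N': "tensor_rels G' H' \<lhd> tensor_free G' H'"
    by (rule tensor_rels_normal[OF G], rule tensor_rels_normal[OF G'])
  interpret N': normal "tensor_rels G' H'" "tensor_free G' H'" by (rule N')
  let ?q = "\<lambda>a. tensor_rels G' H' #>\<^bsub>tensor_free G' H'\<^esub> ?e a"
  have q: "?q \<in> hom (tensor_free G H) (tensor G' H')"
    using hom_compose[OF e N'.r_coset_hom_Mod] by (simp add: tensor_def o_def)
  have sub: "?e ` tensor_rels G H \<subseteq> tensor_rels G' H'"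
  proof (rule image_subsetI)
    fix a assume a: "a \<in> tensor_rels G H"
    have ac: "a \<in> carrier (tensor_free G H)"
      using subgroup.mem_carrier[OF normal_imp_subgroup[OF N]] a by auto
    have "?q a = \<one>\<^bsub>tensor G' H'\<^esub>"
    proof (rule hom_kills_tensor_rels[OF G group_tensor[OF G'] q _ _ _ a])
      show "?q (frag_of (x, y)) = tens G' H' (f x) (g y)" for x y
        by (simp add: tens_def)
      show "(\<lambda>x. tens G' H' (f x) (g y)) \<in> hom G (tensor G' H')" if "y \<in> carrier H" for y
        using hom_compose[OF f tens_hom_left[OF G' gc[OF that]]] by (simp add: o_def)
      show "(\<lambda>y. tens G' H' (f x) (g y)) \<in> hom H (tensor G' H')" if "x \<in> carrier G" for x
        using hom_compose[OF g tens_hom_right[OF G' fc[OF that]]] by (simp add: o_def)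
    qed
    then have "?q a = tensor_rels G' H'" by (simp add: tensor_def)
    moreover
    have "?e a \<in> carrier (tensor_free G' H')" using e ac by (auto simp: hom_def)
    from N'.rcos_self[OF this N'.subgroup_axioms]
    have "?e a \<in> ?q a" .
    ultimately show "?e a \<in> tensor_rels G' H'" by (simp only:)
  qed
  show "tensor_map G' H' f g \<in> hom (tensor G H) (tensor G' H')"
    unfolding tensor_map_def tensor_def by (rule quot_map_hom[OF N N' e sub])
  fix x y assume xy: "x \<in> carrier G" "y \<in> carrier H"
  show "tensor_map G' H' f g (tens G H x y) = tens G' H' (f x) (g y)"
    unfolding tensor_map_def tens_def
    using quot_map_coset[OF normal.axioms(2)[OF N] normal_imp_subgroup[OF N]
        normal.axioms(2)[OF N'] normal_imp_subgroup[OF N'] e sub, of "frag_of (x, y)"] xy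
    by (simp add: tensor_free_def)
qed

section \<open>Tensoring a complex with a group in degree zero\<close>

text \<open>
  In degree \<open>n\<close> the only summand of \<open>C \<otimes> A\<close>, for a group \<open>A\<close> in degree zero, that is not
  trivial is the one with \<open>p = n\<close>. The element \<open>pure_tensor C A n x y\<close> is \<open>x \<otimes> y\<close>
  in that summand.
\<close>

definition pure_tensor ::
    "'g ch \<Rightarrow> 'h monoid \<Rightarrow> int \<Rightarrow> 'g \<Rightarrow> 'h \<Rightarrow> int \<Rightarrow> ('g \<times> 'h \<Rightarrow>\<^sub>0 int) set" where
  "pure_tensor C A n x y =
     sum_incl UNIV (\<lambda>p. tensor (grp C p) (grp (conc0 A) (n - p))) n (tens (grp C n) A x y)"

lemma grp_conc0_0 [simp]: "grp (conc0 A) 0 = A"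
  by (simp add: conc0_def)

lemma grp_conc0_other: "n \<noteq> 0 \<Longrightarrow> grp (conc0 A) n = singleton_group \<one>\<^bsub>A\<^esub>"
  by (simp add: conc0_def)

lemma group_grp_conc0: "group A \<Longrightarrow> group (grp (conc0 A) n)"
  by (simp add: conc0_def)

lemma one_grp_conc0 [simp]: "\<one>\<^bsub>grp (conc0 A) n\<^esub> = \<one>\<^bsub>A\<^esub>"
  by (simp add: conc0_def singleton_group_def)

lemma conc0_map_hom:
  assumes "group A" "group B" "g \<in> hom A B"
  shows "conc0_map B g n \<in> hom (grp (conc0 A) n) (grp (conc0 B) n)"
  using assms by (simp add: conc0_def conc0_map_def)

lemma grp_ch_tensor:
  "grp (ch_tensor C D) n = sum_group UNIV (\<lambda>p. tensor (grp C p) (grp D (n - p)))"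
  by (simp add: ch_tensor_def)

lemma grp_ch_sum: "grp (ch_sum I C) n = sum_group I (\<lambda>i. grp (C i) n)"
  by (simp add: ch_sum_def)

lemma ch_sum_incl_eq: "ch_sum_incl I C i n = sum_incl I (\<lambda>i. grp (C i) n) i"
  by (simp add: ch_sum_incl_def sum_incl_def fun_eq_iff)

text \<open>
  By bilinearity \<open>x \<otimes> 1 = 1\<close>, and these are all the pure tensors there are.
\<close>

lemma carrier_tensor_singleton:
  assumes "group G"
  shows "carrier (tensor G (singleton_group a)) = {\<one>\<^bsub>tensor G (singleton_group a)\<^esub>}"
proof -
  have one: "\<one>\<^bsub>singleton_group a\<^esub> = a" by (simp add: singleton_group_def)
  interpret T: group "tensor G (singleton_group a)" by (simp add: group_tensor assms)
  have "{tens G (singleton_group a) x y | x y. x \<in> carrier G \<and> y \<in> carrier (singleton_group a)}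
      \<subseteq> {\<one>\<^bsub>tensor G (singleton_group a)\<^esub>}"
    using tens_one_right[OF assms singleton_group[of a]] one by auto
  moreover have "subgroup {\<one>\<^bsub>tensor G (singleton_group a)\<^esub>} (tensor G (singleton_group a))"
    by (rule T.triv_subgroup)
  ultimately have "carrier (tensor G (singleton_group a)) \<subseteq> {\<one>\<^bsub>tensor G (singleton_group a)\<^esub>}"
    using generated_subset_subgroup[OF tensor_generated[OF assms singleton_group] T.is_group] by blast
  then show ?thesis by auto
qed

context
  fixes C :: "'g ch" and A :: "'h monoid"
  assumes C: "\<And>n. group (grp C n)" and A: "group A"
begin

lemma tensor_conc0_trivial:
  assumes "p \<noteq> n" "t \<in> carrier (tensor (grp C p) (grp (conc0 A) (n - p)))"
  shows "t = \<one>\<^bsub>tensor (grp C p) (grp (conc0 A) (n - p))\<^esub>"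
  using assms by (simp add: grp_conc0_other carrier_tensor_singleton[OF C])

lemma group_tensor_conc0: "group (tensor (grp C p) (grp (conc0 A) n))"
  by (intro group_tensor C group_grp_conc0 A)

lemma comm_group_ch_tensor: "comm_group (grp (ch_tensor C (conc0 A)) n)"
  unfolding grp_ch_tensor by (intro comm_group_sum_group comm_group_tensor C group_grp_conc0 A)

lemma pure_tensor_hom_tensor:
  "sum_incl UNIV (\<lambda>p. tensor (grp C p) (grp (conc0 A) (n - p))) n
     \<in> hom (tensor (grp C n) A) (grp (ch_tensor C (conc0 A)) n)"
  using sum_incl_hom[of UNIV "\<lambda>p. tensor (grp C p) (grp (conc0 A) (n - p))" n]
  by (simp add: grp_ch_tensor group_tensor_conc0)

lemma pure_tensor_closed:
  "x \<in> carrier (grp C n) \<Longrightarrow> y \<in> carrier A \<Longrightarrow> pure_tensor C A n x y \<in> carrier (grp (ch_tensor C (conc0 A)) n)"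
  unfolding pure_tensor_def by (intro hom_in_carrier[OF pure_tensor_hom_tensor] tens_closed)

lemma pure_tensor_hom_left:
  assumes "y \<in> carrier A"
  shows "(\<lambda>x. pure_tensor C A n x y) \<in> hom (grp C n) (grp (ch_tensor C (conc0 A)) n)"
  using hom_compose[OF tens_hom_left[OF C A assms] pure_tensor_hom_tensor]
  by (simp add: pure_tensor_def o_def)

lemma pure_tensor_hom_right:
  assumes "x \<in> carrier (grp C n)"
  shows "pure_tensor C A n x \<in> hom A (grp (ch_tensor C (conc0 A)) n)"
  using hom_compose[OF tens_hom_right[OF C A assms] pure_tensor_hom_tensor]
  by (simp add: pure_tensor_def[abs_def] o_def)

lemma ch_tensor_conc0_generated:
  "carrier (grp (ch_tensor C (conc0 A)) n) = generate (grp (ch_tensor C (conc0 A)) n)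
     {pure_tensor C A n x y | x y. x \<in> carrier (grp C n) \<and> y \<in> carrier A}"
proof -
  let ?T = "\<lambda>p. tensor (grp C p) (grp (conc0 A) (n - p))"
  let ?S = "\<lambda>p. if p = n then {tens (grp C n) A x y | x y. x \<in> carrier (grp C n) \<and> y \<in> carrier A} else {}"
  have gen: "carrier (?T p) = generate (?T p) (?S p)" for p
  proof (cases "p = n")
    case True
    then show ?thesis using tensor_generated[OF C A] by simp
  next
    case False
    then have "carrier (?T p) = {\<one>\<^bsub>?T p\<^esub>}"
      by (simp add: grp_conc0_other carrier_tensor_singleton[OF C])
    then show ?thesis using False group.generate_empty[OF group_tensor_conc0] by simp
  qed
  have "carrier (sum_group UNIV ?T) = generate (sum_group UNIV ?T) (\<Union>p\<in>UNIV. sum_incl UNIV ?T p ` ?S p)"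
    by (rule sum_group_generated[OF group_tensor_conc0 gen])
  moreover have "(\<Union>p\<in>UNIV. sum_incl UNIV ?T p ` ?S p)
      = {pure_tensor C A n x y | x y. x \<in> carrier (grp C n) \<and> y \<in> carrier A}"
  proof -
    have "(\<Union>p\<in>UNIV. sum_incl UNIV ?T p ` (if p = n then V else {})) = sum_incl UNIV ?T n ` V" for V
      by (auto split: if_splits)
    moreover have "{pure_tensor C A n x y | x y. x \<in> carrier (grp C n) \<and> y \<in> carrier A}
        = sum_incl UNIV ?T n ` {tens (grp C n) A x y | x y. x \<in> carrier (grp C n) \<and> y \<in> carrier A}"
      unfolding pure_tensor_def by blast
    ultimately show ?thesis by (simp only:)
  qed
  ultimately show ?thesis by (simp only: grp_ch_tensor)
qed

text \<open>
  Of the two terms in the differential of the tensor product, the one that uses the differential of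
  \<open>conc0 A\<close> always vanishes: its source is a trivial summand if \<open>p \<noteq> n\<close>, its target is
  one if \<open>p = n\<close>. What remains is \<open>bd C\<close> applied to the left factor.
\<close>

lemma
  assumes d: "\<And>n. bd C n \<in> hom (grp C n) (grp C (n - 1))"
  shows bd_ch_tensor_hom: "bd (ch_tensor C (conc0 A)) n
      \<in> hom (grp (ch_tensor C (conc0 A)) n) (grp (ch_tensor C (conc0 A)) (n - 1))"
    and bd_pure_tensor: "x \<in> carrier (grp C n) \<Longrightarrow> y \<in> carrier A \<Longrightarrow>
      bd (ch_tensor C (conc0 A)) n (pure_tensor C A n x y) = pure_tensor C A (n - 1) (bd C n x) y"
proof -
  let ?G = "\<lambda>p. tensor (grp C p) (grp (conc0 A) (n - p))"
  let ?H = "\<lambda>p. tensor (grp C p) (grp (conc0 A) (n - 1 - p))"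
  let ?f = "\<lambda>p. tensor_map (grp C p) (grp (conc0 A) (n - 1 - p)) (bd C (p + 1)) (\<lambda>y. y)"
  let ?g = "\<lambda>p. tensor_map (grp C p) (grp (conc0 A) (n - 1 - p)) (\<lambda>x. x) (bd (conc0 A) (n - p))"
  have shift: "n - 1 - p = n - (p + 1)" for p by simp
  have id: "(\<lambda>x. x) \<in> hom G G" for G :: "'z monoid" by (simp add: hom_def)
  have f: "?f p \<in> hom (?G (p + 1)) (?H p)" for p
    unfolding shift
    by (rule tensor_map_hom) (use C A d[of "p + 1"] id in \<open>simp_all add: group_grp_conc0\<close>)
  have bd0: "bd (conc0 A) (n - p) \<in> hom (grp (conc0 A) (n - p)) (grp (conc0 A) (n - 1 - p))" for p
    using A by (auto simp: conc0_def hom_def group.is_monoid monoid.one_closed singleton_group_def)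
  have g: "?g p \<in> hom (?G p) (?H p)" for p
    by (rule tensor_map_hom) (use C A bd0 id in \<open>simp_all add: group_grp_conc0\<close>)
  have g1: "?g p t = \<one>\<^bsub>?H p\<^esub>" if t: "t \<in> carrier (?G p)" for p t
  proof (cases "p = n")
    case True
    have "?g p t \<in> carrier (?H p)" using hom_in_carrier[OF g t] .
    then show ?thesis
      by (rule tensor_conc0_trivial[rotated]) (use True in simp)
  next
    case False
    then have "t = \<one>\<^bsub>?G p\<^esub>" using tensor_conc0_trivial t by blast
    then show ?thesis using hom_one[OF g group_tensor_conc0 group_tensor_conc0] by simp
  qed
  have bd_eq: "bd (ch_tensor C (conc0 A)) n z = (\<lambda>p. ?f p (z (p + 1)))"
    if z: "z \<in> carrier (sum_group UNIV ?G)" for z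
  proof
    fix p
    interpret Hp: group "?H p" by (rule group_tensor_conc0)
    have zc: "z q \<in> carrier (?G q)" for q
      using z by (auto simp: carrier_sum_group group_tensor_conc0)
    have "?f p (z (p + 1)) \<in> carrier (?H p)" by (rule hom_in_carrier[OF f zc])
    then show "bd (ch_tensor C (conc0 A)) n z p = ?f p (z (p + 1))"
      by (simp add: ch_tensor_def Let_def g1[OF zc])
  qed
  have hom: "(\<lambda>z p. ?f p (z (p + 1))) \<in> hom (sum_group UNIV ?G) (sum_group UNIV ?H)"
  proof (rule homI)
    fix z assume z: "z \<in> carrier (sum_group UNIV ?G)"
    have zc: "z q \<in> carrier (?G q)" for q
      using z by (auto simp: carrier_sum_group group_tensor_conc0)
    have fc: "?f p (z (p + 1)) \<in> carrier (?H p)" for p by (rule hom_in_carrier[OF f zc])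
    then have "?f p (z (p + 1)) = \<one>\<^bsub>?H p\<^esub>" if "p \<noteq> n - 1" for p
      using tensor_conc0_trivial[OF that] by blast
    then have "{p \<in> UNIV. ?f p (z (p + 1)) \<noteq> \<one>\<^bsub>?H p\<^esub>} \<subseteq> {n - 1}"
      by blast
    then have "finite {p \<in> UNIV. ?f p (z (p + 1)) \<noteq> \<one>\<^bsub>?H p\<^esub>}"
      by (rule finite_subset) simp
    then show "(\<lambda>p. ?f p (z (p + 1))) \<in> carrier (sum_group UNIV ?H)"
      using fc by (simp add: carrier_sum_group group_tensor_conc0 PiE_iff)
  next
    fix z w assume zw: "z \<in> carrier (sum_group UNIV ?G)" "w \<in> carrier (sum_group UNIV ?G)"
    have "z q \<in> carrier (?G q)" "w q \<in> carrier (?G q)" for q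
      using zw by (auto simp: carrier_sum_group group_tensor_conc0)
    then show "(\<lambda>p. ?f p ((z \<otimes>\<^bsub>sum_group UNIV ?G\<^esub> w) (p + 1)))
        = (\<lambda>p. ?f p (z (p + 1))) \<otimes>\<^bsub>sum_group UNIV ?H\<^esub> (\<lambda>p. ?f p (w (p + 1)))"
      by (simp add: fun_eq_iff hom_mult[OF f])
  qed
  then show "bd (ch_tensor C (conc0 A)) n
      \<in> hom (grp (ch_tensor C (conc0 A)) n) (grp (ch_tensor C (conc0 A)) (n - 1))"
    unfolding grp_ch_tensor
    by (rule hom_cong_on) (use bd_eq in \<open>auto simp: group_tensor_conc0\<close>)
  assume xy: "x \<in> carrier (grp C n)" "y \<in> carrier A"
  have pc: "pure_tensor C A n x y \<in> carrier (sum_group UNIV ?G)"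
    using pure_tensor_closed[OF xy] by (simp only: grp_ch_tensor)
  have "?f p (pure_tensor C A n x y (p + 1)) = pure_tensor C A (n - 1) (bd C n x) y p" for p
  proof (cases "p = n - 1")
    case True
    have "?f (n - 1) (tens (grp C n) A x y) = tens (grp C (n - 1)) A (bd C n x) y"
      using tensor_map_tens[of "grp C n" A "grp C (n - 1)" A "bd C n" "\<lambda>y. y" x y] C A d xy id[of A] by simp
    then show ?thesis using True by (simp add: pure_tensor_def sum_incl_def)
  next
    case False
    then show ?thesis
      using hom_one[OF f group_tensor_conc0 group_tensor_conc0, of p]
      by (simp add: pure_tensor_def sum_incl_def)
  qed
  then show "bd (ch_tensor C (conc0 A)) n (pure_tensor C A n x y) = pure_tensor C A (n - 1) (bd C n x) y"
    using bd_eq[OF pc] by (simp add: fun_eq_iff)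
qed

end

lemma
  assumes C: "\<And>n. group (grp C n)" "\<And>n. group (grp C' n)" and A: "group A" "group A'"
    and f: "\<And>n. f n \<in> hom (grp C n) (grp C' n)"
    and h: "\<And>n. h n \<in> hom (grp (conc0 A) n) (grp (conc0 A') n)"
  shows ch_tensor_map_hom: "ch_tensor_map C' (conc0 A') f h n
      \<in> hom (grp (ch_tensor C (conc0 A)) n) (grp (ch_tensor C' (conc0 A')) n)"
    and ch_tensor_map_pure: "x \<in> carrier (grp C n) \<Longrightarrow> y \<in> carrier A \<Longrightarrow>
      ch_tensor_map C' (conc0 A') f h n (pure_tensor C A n x y) = pure_tensor C' A' n (f n x) (h 0 y)"
proof -
  let ?G = "\<lambda>p. tensor (grp C p) (grp (conc0 A) (n - p))"
  let ?H = "\<lambda>p. tensor (grp C' p) (grp (conc0 A') (n - p))"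
  let ?f = "\<lambda>p. tensor_map (grp C' p) (grp (conc0 A') (n - p)) (f p) (h (n - p))"
  have fh: "?f p \<in> hom (?G p) (?H p)" for p
    by (intro tensor_map_hom C group_grp_conc0 A f h)
  have gG: "group (?G p)" and gH: "group (?H p)" for p
    by (intro group_tensor C group_grp_conc0 A)+
  have "(\<lambda>z. \<lambda>p\<in>UNIV. ?f p (z p)) \<in> hom (sum_group UNIV ?G) (sum_group UNIV ?H)"
    by (rule sum_group_map_hom) (use fh gG gH in auto)
  then show "ch_tensor_map C' (conc0 A') f h n
      \<in> hom (grp (ch_tensor C (conc0 A)) n) (grp (ch_tensor C' (conc0 A')) n)"
    by (simp add: ch_tensor_map_def[abs_def] grp_ch_tensor restrict_def)
  assume xy: "x \<in> carrier (grp C n)" "y \<in> carrier A"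
  have "?f n (tens (grp C n) A x y) = tens (grp C' n) A' (f n x) (h 0 y)"
    using tensor_map_tens[of "grp C n" A "grp C' n" A' "f n" "h 0" x y] C A f h[of 0] xy by simp
  then show "ch_tensor_map C' (conc0 A') f h n (pure_tensor C A n x y) = pure_tensor C' A' n (f n x) (h 0 y)"
    using hom_one[OF fh gG gH]
    by (auto simp: ch_tensor_map_def pure_tensor_def sum_incl_def fun_eq_iff)
qed

section \<open>The two maps that define the coend\<close>

locale coend_data =
  fixes F :: "('g ch, int \<Rightarrow> 'g \<Rightarrow> 'g) diagram" and A :: "('h monoid, 'h \<Rightarrow> 'h) diagram"
  assumes F: "ch_functor F"
    and A_group: "\<And>l. 0 \<le> l \<Longrightarrow> group (Ob A l)"
    and A_hom: "\<And>l l'. 0 \<le> l \<Longrightarrow> l \<le> l' \<Longrightarrow> Ar A l l' \<in> hom (Ob A l') (Ob A l)"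
begin

lemma F_comm_group: "0 \<le> l \<Longrightarrow> comm_group (grp (Ob F l) n)"
  using F by (auto simp: ch_functor_def is_chain_complex_def)

lemma F_group: "0 \<le> l \<Longrightarrow> group (grp (Ob F l) n)"
  using F_comm_group by (simp add: comm_group_def)

lemma F_bd: "0 \<le> l \<Longrightarrow> bd (Ob F l) n \<in> hom (grp (Ob F l) n) (grp (Ob F l) (n - 1))"
  using F by (auto simp: ch_functor_def is_chain_complex_def)

lemma F_hom: "0 \<le> l \<Longrightarrow> l \<le> l' \<Longrightarrow> Ar F l l' n \<in> hom (grp (Ob F l) n) (grp (Ob F l') n)"
  using F by (auto simp: ch_functor_def is_chain_map_def)

lemma F_chain: "0 \<le> l \<Longrightarrow> l \<le> l' \<Longrightarrow> x \<in> carrier (grp (Ob F l) n) \<Longrightarrow>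
    Ar F l l' (n - 1) (bd (Ob F l) n x) = bd (Ob F l') n (Ar F l l' n x)"
  using F by (auto simp: ch_functor_def is_chain_map_def)

lemma F_id: "0 \<le> l \<Longrightarrow> x \<in> carrier (grp (Ob F l) n) \<Longrightarrow> Ar F l l n x = x"
  using F by (auto simp: ch_functor_def)

lemma F_comp: "0 \<le> l \<Longrightarrow> l \<le> l' \<Longrightarrow> l' \<le> l'' \<Longrightarrow> x \<in> carrier (grp (Ob F l) n) \<Longrightarrow>
    Ar F l' l'' n (Ar F l l' n x) = Ar F l l'' n x"
  using F by (auto simp: ch_functor_def)

text \<open>
  The generators of the direct sums in the coequaliser diagram: \<open>target_gen n l x k\<close> is \<open>x \<otimes> k\<close>
  in the summand \<open>l\<close> of the target, and \<open>source_gen n l l' x k\<close> is \<open>x \<otimes> k\<close> in the summand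
  \<open>(l, l')\<close> of the source.
\<close>

definition target_gen :: "int \<Rightarrow> real \<Rightarrow> 'g \<Rightarrow> 'h \<Rightarrow> real \<Rightarrow> int \<Rightarrow> ('g \<times> 'h \<Rightarrow>\<^sub>0 int) set" where
  "target_gen n l x k = sum_incl {0..} (\<lambda>l. grp (coend_summand F A l l) n) l (pure_tensor (Ob F l) (Ob A l) n x k)"

definition source_gen ::
    "int \<Rightarrow> real \<Rightarrow> real \<Rightarrow> 'g \<Rightarrow> 'h \<Rightarrow> real \<times> real \<Rightarrow> int \<Rightarrow> ('g \<times> 'h \<Rightarrow>\<^sub>0 int) set" where
  "source_gen n l l' x k = sum_incl coend_index (\<lambda>(l, l'). grp (coend_summand F A l l') n) (l, l')
     (pure_tensor (Ob F l) (Ob A l') n x k)"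

lemma grp_target: "grp (coend_target F A) n = sum_group {0..} (\<lambda>l. grp (coend_summand F A l l) n)"
  by (simp add: coend_target_def grp_ch_sum)

lemma grp_source:
  "grp (coend_source F A) n = sum_group coend_index (\<lambda>(l, l'). grp (coend_summand F A l l') n)"
  by (simp add: coend_source_def grp_ch_sum case_prod_unfold)

lemma summand_comm_group:
  "0 \<le> l \<Longrightarrow> 0 \<le> l' \<Longrightarrow> comm_group (grp (coend_summand F A l l') n)"
  unfolding coend_summand_def by (intro comm_group_ch_tensor F_group A_group)

lemma summand_group:
  "0 \<le> l \<Longrightarrow> 0 \<le> l' \<Longrightarrow> group (grp (coend_summand F A l l') n)"
  using summand_comm_group by (simp add: comm_group_def)

lemma target_comm_group: "comm_group (grp (coend_target F A) n)"
  unfolding grp_target by (intro comm_group_sum_group summand_comm_group) auto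

lemma target_group: "group (grp (coend_target F A) n)"
  using target_comm_group by (simp add: comm_group_def)

lemma source_group: "group (grp (coend_source F A) n)"
  unfolding grp_source by (intro sum_group) (auto simp: coend_index_def summand_group)

lemma target_incl_hom:
  "0 \<le> l \<Longrightarrow> sum_incl {0..} (\<lambda>l. grp (coend_summand F A l l) n) l
     \<in> hom (grp (coend_summand F A l l) n) (grp (coend_target F A) n)"
  using sum_incl_hom[of "{0..}" "\<lambda>l. grp (coend_summand F A l l) n" l] summand_group
  by (simp add: grp_target)

lemma target_gen_hom_left:
  assumes "0 \<le> l" "k \<in> carrier (Ob A l)"
  shows "(\<lambda>x. target_gen n l x k) \<in> hom (grp (Ob F l) n) (grp (coend_target F A) n)"
  using hom_compose[OF pure_tensor_hom_left[OF F_group A_group assms(2)]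
      target_incl_hom[unfolded coend_summand_def]] assms(1)
  by (simp add: target_gen_def coend_summand_def o_def)

lemma target_gen_hom_right:
  assumes "0 \<le> l" "x \<in> carrier (grp (Ob F l) n)"
  shows "target_gen n l x \<in> hom (Ob A l) (grp (coend_target F A) n)"
  using hom_compose[OF pure_tensor_hom_right[OF F_group A_group assms(2)]
      target_incl_hom[unfolded coend_summand_def]] assms(1)
  by (simp add: target_gen_def[abs_def] coend_summand_def o_def)

lemma target_gen_closed:
  "0 \<le> l \<Longrightarrow> x \<in> carrier (grp (Ob F l) n) \<Longrightarrow> k \<in> carrier (Ob A l) \<Longrightarrow>
     target_gen n l x k \<in> carrier (grp (coend_target F A) n)"
  by (rule hom_in_carrier[OF target_gen_hom_right])

lemma target_gen_one:
  "0 \<le> l \<Longrightarrow> x \<in> carrier (grp (Ob F l) n) \<Longrightarrow>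
     target_gen n l x \<one>\<^bsub>Ob A l\<^esub> = \<one>\<^bsub>grp (coend_target F A) n\<^esub>"
  by (rule hom_one[OF target_gen_hom_right A_group target_group])

lemma target_generated:
  "carrier (grp (coend_target F A) n) = generate (grp (coend_target F A) n)
     {target_gen n l x k | l x k. 0 \<le> l \<and> x \<in> carrier (grp (Ob F l) n) \<and> k \<in> carrier (Ob A l)}"
proof -
  let ?G = "\<lambda>l. grp (coend_summand F A l l) n"
  let ?S = "\<lambda>l. {pure_tensor (Ob F l) (Ob A l) n x y | x y.
      x \<in> carrier (grp (Ob F l) n) \<and> y \<in> carrier (Ob A l)}"
  have "carrier (sum_group {0..} ?G) = generate (sum_group {0..} ?G) (\<Union>l\<in>{0..}. sum_incl {0..} ?G l ` ?S l)"
  proof (rule sum_group_generated)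
    show "group (?G l)" if "l \<in> {0..}" for l using that by (simp add: summand_group)
    show "carrier (?G l) = generate (?G l) (?S l)" if "l \<in> {0..}" for l
      unfolding coend_summand_def
      by (rule ch_tensor_conc0_generated) (use that F_group A_group in auto)
  qed
  moreover have "(\<Union>l\<in>{0..}. sum_incl {0..} ?G l ` ?S l)
      = {target_gen n l x k | l x k. 0 \<le> l \<and> x \<in> carrier (grp (Ob F l) n) \<and> k \<in> carrier (Ob A l)}"
    unfolding target_gen_def by (auto 4 4)
  ultimately show ?thesis by (simp only: grp_target)
qed

lemma source_gen_closed:
  assumes "0 \<le> l" "l \<le> l'" "x \<in> carrier (grp (Ob F l) n)" "k \<in> carrier (Ob A l')"
  shows "source_gen n l l' x k \<in> carrier (grp (coend_source F A) n)"
proof -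
  have "sum_incl coend_index (\<lambda>(l, l'). grp (coend_summand F A l l') n) (l, l')
      \<in> hom (grp (coend_summand F A l l') n) (grp (coend_source F A) n)"
    using sum_incl_hom[of coend_index "\<lambda>(l, l'). grp (coend_summand F A l l') n" "(l, l')"] assms
    unfolding grp_source by (auto simp: coend_index_def summand_group)
  moreover have "pure_tensor (Ob F l) (Ob A l') n x k \<in> carrier (grp (coend_summand F A l l') n)"
    unfolding coend_summand_def by (rule pure_tensor_closed) (use assms F_group A_group in auto)
  ultimately show ?thesis unfolding source_gen_def by (rule hom_in_carrier)
qed

lemma source_generated:
  "carrier (grp (coend_source F A) n) = generate (grp (coend_source F A) n)
     {source_gen n l l' x k | l l' x k. 0 \<le> l \<and> l \<le> l' \<and> x \<in> carrier (grp (Ob F l) n) \<and> k \<in> carrier (Ob A l')}"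
proof -
  let ?G = "\<lambda>(l, l'). grp (coend_summand F A l l') n"
  let ?S = "\<lambda>(l, l'). {pure_tensor (Ob F l) (Ob A l') n x y | x y.
      x \<in> carrier (grp (Ob F l) n) \<and> y \<in> carrier (Ob A l')}"
  have "carrier (sum_group coend_index ?G)
      = generate (sum_group coend_index ?G) (\<Union>i\<in>coend_index. sum_incl coend_index ?G i ` ?S i)"
  proof (rule sum_group_generated)
    show "group (?G i)" if "i \<in> coend_index" for i
      using that by (auto simp: summand_group coend_index_def)
    show "carrier (?G i) = generate (?G i) (?S i)" if "i \<in> coend_index" for i
    proof -
      obtain l l' where i: "i = (l, l')" "0 \<le> l" "l \<le> l'" using \<open>i \<in> coend_index\<close> by (auto simp: coend_index_def)
      show ?thesis
        unfolding i(1) coend_summand_def prod.case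
        by (rule ch_tensor_conc0_generated) (use i F_group A_group in auto)
    qed
  qed
  moreover have "(\<Union>i\<in>coend_index. sum_incl coend_index ?G i ` ?S i)
      = {source_gen n l l' x k | l l' x k. 0 \<le> l \<and> l \<le> l' \<and> x \<in> carrier (grp (Ob F l) n) \<and> k \<in> carrier (Ob A l')}"
    unfolding source_gen_def coend_index_def by (auto 4 4)
  ultimately show ?thesis by (simp only: grp_source)
qed

text \<open>
  Both maps in the coequaliser diagram are given by their components on the summands of the source.
\<close>

lemma
  assumes f: "\<And>l l'. 0 \<le> l \<Longrightarrow> l \<le> l' \<Longrightarrow>
      f (l, l') n \<in> hom (grp (coend_summand F A l l') n) (grp (coend_target F A) n)"
  shows source_desc_hom: "ch_sum_desc coend_index (coend_target F A) f n
      \<in> hom (grp (coend_source F A) n) (grp (coend_target F A) n)"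
    and source_desc_gen: "0 \<le> l \<Longrightarrow> l \<le> l' \<Longrightarrow> x \<in> carrier (grp (Ob F l) n) \<Longrightarrow> k \<in> carrier (Ob A l') \<Longrightarrow>
      ch_sum_desc coend_index (coend_target F A) f n (source_gen n l l' x k)
        = f (l, l') n (pure_tensor (Ob F l) (Ob A l') n x k)"
proof -
  interpret T: comm_group "grp (coend_target F A) n" by (rule target_comm_group)
  let ?G = "\<lambda>(l, l'). grp (coend_summand F A l l') n"
  have G: "group (?G i)" if "i \<in> coend_index" for i
    using that by (auto simp: summand_group coend_index_def)
  have f': "f i n \<in> hom (?G i) (grp (coend_target F A) n)" if "i \<in> coend_index" for i
    using that f by (auto simp: coend_index_def)
  show "ch_sum_desc coend_index (coend_target F A) f n
      \<in> hom (grp (coend_source F A) n) (grp (coend_target F A) n)"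
    using T.hom_group_sum[of coend_index "\<lambda>i. f i n" ?G, OF f' G]
    by (simp add: ch_sum_desc_def[abs_def] grp_source)
  assume l: "0 \<le> l" "l \<le> l'" and xk: "x \<in> carrier (grp (Ob F l) n)" "k \<in> carrier (Ob A l')"
  then have i: "(l, l') \<in> coend_index" by (simp add: coend_index_def)
  have "pure_tensor (Ob F l) (Ob A l') n x k \<in> carrier (grp (coend_summand F A l l') n)"
    unfolding coend_summand_def by (rule pure_tensor_closed) (use l xk F_group A_group in auto)
  then show "ch_sum_desc coend_index (coend_target F A) f n (source_gen n l l' x k)
        = f (l, l') n (pure_tensor (Ob F l) (Ob A l') n x k)"
    using gfinprod_incl[of "grp (coend_target F A) n" coend_index ?G "\<lambda>i. f i n" "(l, l')", OF T.comm_group_axioms G f' i]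
    by (simp add: ch_sum_desc_def source_gen_def)
qed

lemma
  shows cov_hom: "coend_cov F A n \<in> hom (grp (coend_source F A) n) (grp (coend_target F A) n)"
    and cov_gen: "0 \<le> l \<Longrightarrow> l \<le> l' \<Longrightarrow> x \<in> carrier (grp (Ob F l) n) \<Longrightarrow> k \<in> carrier (Ob A l') \<Longrightarrow>
      coend_cov F A n (source_gen n l l' x k) = target_gen n l' (Ar F l l' n x) k"
proof -
  have id: "(\<lambda>x. x) \<in> hom G G" for G :: "'h monoid" by (simp add: hom_def)
  let ?m = "\<lambda>l l'. ch_tensor_map (Ob F l') (conc0 (Ob A l')) (Ar F l l') (\<lambda>_ y. y) n"
  have m: "?m l l' \<in> hom (grp (coend_summand F A l l') n) (grp (coend_summand F A l' l') n)"
    if "0 \<le> l" "l \<le> l'" for l l'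
    unfolding coend_summand_def
    by (rule ch_tensor_map_hom) (use that F_group A_group F_hom id in auto)
  let ?f = "\<lambda>(l, l') n z. ch_sum_incl {0..} (\<lambda>m. coend_summand F A m m) l' n
            (ch_tensor_map (Ob F l') (conc0 (Ob A l')) (Ar F l l') (\<lambda>_ y. y) n z)"
  have f: "?f (l, l') n \<in> hom (grp (coend_summand F A l l') n) (grp (coend_target F A) n)"
    if "0 \<le> l" "l \<le> l'" for l l'
    using hom_compose[OF m[OF that] target_incl_hom] that by (simp add: ch_sum_incl_eq o_def)
  show "coend_cov F A n \<in> hom (grp (coend_source F A) n) (grp (coend_target F A) n)"
    unfolding coend_cov_def by (rule source_desc_hom[of ?f n, OF f])
  assume l: "0 \<le> l" "l \<le> l'" and xk: "x \<in> carrier (grp (Ob F l) n)" "k \<in> carrier (Ob A l')"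
  have "?m l l' (pure_tensor (Ob F l) (Ob A l') n x k) = pure_tensor (Ob F l') (Ob A l') n (Ar F l l' n x) k"
    by (rule ch_tensor_map_pure) (use l xk F_group A_group F_hom id in auto)
  then show "coend_cov F A n (source_gen n l l' x k) = target_gen n l' (Ar F l l' n x) k"
    using source_desc_gen[of ?f n, OF f l xk]
    by (simp add: coend_cov_def target_gen_def ch_sum_incl_eq)
qed

lemma
  shows contra_hom: "coend_contra F A n \<in> hom (grp (coend_source F A) n) (grp (coend_target F A) n)"
    and contra_gen: "0 \<le> l \<Longrightarrow> l \<le> l' \<Longrightarrow> x \<in> carrier (grp (Ob F l) n) \<Longrightarrow> k \<in> carrier (Ob A l') \<Longrightarrow>
      coend_contra F A n (source_gen n l l' x k) = target_gen n l x (Ar A l l' k)"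
proof -
  have id: "(\<lambda>x. x) \<in> hom G G" for G :: "'g monoid" by (simp add: hom_def)
  let ?m = "\<lambda>l l'. ch_tensor_map (Ob F l) (conc0 (Ob A l)) (\<lambda>_ x. x) (conc0_map (Ob A l) (Ar A l l')) n"
  have c: "conc0_map (Ob A l) (Ar A l l') q \<in> hom (grp (conc0 (Ob A l')) q) (grp (conc0 (Ob A l)) q)"
    if "0 \<le> l" "l \<le> l'" for l l' q
    by (rule conc0_map_hom) (use that A_group A_hom in auto)
  have m: "?m l l' \<in> hom (grp (coend_summand F A l l') n) (grp (coend_summand F A l l) n)"
    if "0 \<le> l" "l \<le> l'" for l l'
    unfolding coend_summand_def
    by (rule ch_tensor_map_hom) (use that F_group A_group c id in auto)
  let ?f = "\<lambda>(l, l') n z. ch_sum_incl {0..} (\<lambda>m. coend_summand F A m m) l n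
            (ch_tensor_map (Ob F l) (conc0 (Ob A l)) (\<lambda>_ x. x) (conc0_map (Ob A l) (Ar A l l')) n z)"
  have f: "?f (l, l') n \<in> hom (grp (coend_summand F A l l') n) (grp (coend_target F A) n)"
    if "0 \<le> l" "l \<le> l'" for l l'
    using hom_compose[OF m[OF that] target_incl_hom] that by (simp add: ch_sum_incl_eq o_def)
  show "coend_contra F A n \<in> hom (grp (coend_source F A) n) (grp (coend_target F A) n)"
    unfolding coend_contra_def by (rule source_desc_hom[of ?f n, OF f])
  assume l: "0 \<le> l" "l \<le> l'" and xk: "x \<in> carrier (grp (Ob F l) n)" "k \<in> carrier (Ob A l')"
  have "?m l l' (pure_tensor (Ob F l) (Ob A l') n x k)
      = pure_tensor (Ob F l) (Ob A l) n x (conc0_map (Ob A l) (Ar A l l') 0 k)"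
    by (rule ch_tensor_map_pure) (use l xk F_group A_group c id in auto)
  then show "coend_contra F A n (source_gen n l l' x k) = target_gen n l x (Ar A l l' k)"
    using source_desc_gen[of ?f n, OF f l xk]
    by (simp add: coend_contra_def target_gen_def ch_sum_incl_eq conc0_map_def)
qed

abbreviation "rels n \<equiv> coeq_rels (coend_source F A) (coend_target F A) (coend_cov F A) (coend_contra F A) n"

text \<open>
  The relations are the image of the difference of two homomorphisms into a commutative group.
\<close>

lemma rels_subgroup: "subgroup (rels n) (grp (coend_target F A) n)"
proof -
  interpret T: comm_group "grp (coend_target F A) n" by (rule target_comm_group)
  let ?h = "\<lambda>x. coend_cov F A n x \<otimes>\<^bsub>grp (coend_target F A) n\<^esub> inv\<^bsub>grp (coend_target F A) n\<^esub> coend_contra F A n x"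
  have c: "coend_cov F A n x \<in> carrier (grp (coend_target F A) n)"
      "coend_contra F A n x \<in> carrier (grp (coend_target F A) n)"
    if "x \<in> carrier (grp (coend_source F A) n)" for x
    using hom_in_carrier[OF cov_hom that] hom_in_carrier[OF contra_hom that] by auto
  have "?h \<in> hom (grp (coend_source F A) n) (grp (coend_target F A) n)"
    by (rule homI) (simp_all add: c hom_mult[OF cov_hom] hom_mult[OF contra_hom] T.inv_mult T.m_ac)
  then interpret h: group_hom "grp (coend_source F A) n" "grp (coend_target F A) n" ?h
    by (simp add: group_hom_def group_hom_axioms_def source_group target_group)
  show ?thesis using h.img_is_subgroup by (simp add: coeq_rels_def)
qed

lemma
  shows target_bd_hom: "bd (coend_target F A) n \<in> hom (grp (coend_target F A) n) (grp (coend_target F A) (n - 1))"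
    and target_bd_gen: "0 \<le> l \<Longrightarrow> x \<in> carrier (grp (Ob F l) n) \<Longrightarrow> k \<in> carrier (Ob A l) \<Longrightarrow>
      bd (coend_target F A) n (target_gen n l x k) = target_gen (n - 1) l (bd (Ob F l) n x) k"
proof -
  let ?G = "\<lambda>n l. grp (coend_summand F A l l) n"
  have G: "group (?G n l)" if "l \<in> {0..}" for n l using that by (simp add: summand_group)
  have b: "bd (coend_summand F A l l) n \<in> hom (?G n l) (?G (n - 1) l)" if "l \<in> {0..}" for l
    unfolding coend_summand_def by (rule bd_ch_tensor_hom) (use that F_group A_group F_bd in auto)
  have eq: "bd (coend_target F A) n = (\<lambda>z. \<lambda>l\<in>{0..}. bd (coend_summand F A l l) n (z l))"
    by (simp add: coend_target_def ch_sum_def)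
  show "bd (coend_target F A) n \<in> hom (grp (coend_target F A) n) (grp (coend_target F A) (n - 1))"
    unfolding eq grp_target by (rule sum_group_map_hom[OF G G b])
  assume l: "0 \<le> l" and xk: "x \<in> carrier (grp (Ob F l) n)" "k \<in> carrier (Ob A l)"
  have "bd (coend_summand F A l l) n (pure_tensor (Ob F l) (Ob A l) n x k)
      = pure_tensor (Ob F l) (Ob A l) (n - 1) (bd (Ob F l) n x) k"
    unfolding coend_summand_def by (rule bd_pure_tensor) (use l xk F_group A_group F_bd in auto)
  then show "bd (coend_target F A) n (target_gen n l x k) = target_gen (n - 1) l (bd (Ob F l) n x) k"
    unfolding eq target_gen_def
    using sum_group_map_incl[of "{0..}" "?G n" "?G (n - 1)" "\<lambda>l. bd (coend_summand F A l l) n" l, OF G G b]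
    by simp
qed

end

locale coend_transformation = A: coend_data F A + B: coend_data F B
  for F :: "('g ch, int \<Rightarrow> 'g \<Rightarrow> 'g) diagram" and A B :: "('h monoid, 'h \<Rightarrow> 'h) diagram" +
  fixes \<tau> :: "real \<Rightarrow> 'h \<Rightarrow> 'h"
  assumes \<tau>: "\<And>l. 0 \<le> l \<Longrightarrow> \<tau> l \<in> hom (Ob A l) (Ob B l)"
begin

definition target_map :: "int \<Rightarrow> (real \<Rightarrow> int \<Rightarrow> ('g \<times> 'h \<Rightarrow>\<^sub>0 int) set) \<Rightarrow>
    (real \<Rightarrow> int \<Rightarrow> ('g \<times> 'h \<Rightarrow>\<^sub>0 int) set)" where
  "target_map = ch_sum_map {0..}
     (\<lambda>l. ch_tensor_map (Ob F l) (conc0 (Ob B l)) (\<lambda>_ x. x) (conc0_map (Ob B l) (\<tau> l)))"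

lemma
  shows target_map_hom: "target_map n \<in> hom (grp (coend_target F A) n) (grp (coend_target F B) n)"
    and target_map_gen: "0 \<le> l \<Longrightarrow> x \<in> carrier (grp (Ob F l) n) \<Longrightarrow> k \<in> carrier (Ob A l) \<Longrightarrow>
      target_map n (A.target_gen n l x k) = B.target_gen n l x (\<tau> l k)"
proof -
  let ?G = "\<lambda>l. grp (coend_summand F A l l) n" and ?H = "\<lambda>l. grp (coend_summand F B l l) n"
  let ?m = "\<lambda>l. ch_tensor_map (Ob F l) (conc0 (Ob B l)) (\<lambda>_ x. x) (conc0_map (Ob B l) (\<tau> l)) n"
  have id: "(\<lambda>x. x) \<in> hom G G" for G :: "'g monoid" by (simp add: hom_def)
  have G: "group (?G l)" "group (?H l)" if "l \<in> {0..}" for l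
    using that by (simp_all add: A.summand_group B.summand_group)
  have c: "conc0_map (Ob B l) (\<tau> l) q \<in> hom (grp (conc0 (Ob A l)) q) (grp (conc0 (Ob B l)) q)"
    if "0 \<le> l" for l q
    by (rule conc0_map_hom) (use that A.A_group B.A_group \<tau> in auto)
  have m: "?m l \<in> hom (?G l) (?H l)" if "l \<in> {0..}" for l
    unfolding coend_summand_def
    by (rule ch_tensor_map_hom) (use that A.F_group A.A_group B.A_group c id in auto)
  have eq: "target_map n = (\<lambda>z. \<lambda>l\<in>{0..}. ?m l (z l))"
    by (simp add: target_map_def ch_sum_map_def fun_eq_iff)
  show "target_map n \<in> hom (grp (coend_target F A) n) (grp (coend_target F B) n)"
    unfolding eq A.grp_target B.grp_target by (rule sum_group_map_hom[OF G m])
  assume l: "0 \<le> l" and xk: "x \<in> carrier (grp (Ob F l) n)" "k \<in> carrier (Ob A l)"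
  have "?m l (pure_tensor (Ob F l) (Ob A l) n x k)
      = pure_tensor (Ob F l) (Ob B l) n x (conc0_map (Ob B l) (\<tau> l) 0 k)"
    by (rule ch_tensor_map_pure) (use l xk A.F_group A.A_group B.A_group c id in auto)
  then show "target_map n (A.target_gen n l x k) = B.target_gen n l x (\<tau> l k)"
    unfolding eq A.target_gen_def B.target_gen_def
    using sum_group_map_incl[of "{0..}" ?G ?H ?m l, OF G m] by (simp add: conc0_map_def)
qed

lemma coend_map_eq: "coend_map F B \<tau> n = quot_map (grp (coend_target F B) n) (B.rels n) (target_map n)"
  by (simp add: coend_map_def target_map_def)

end

section \<open>The co-Yoneda isomorphism\<close>

lemma group_coeff_Ob: "group (Ob (coeff \<epsilon>) l)"
  by (simp add: coeff_def)

lemma one_coeff_Ob [simp]: "\<one>\<^bsub>Ob (coeff \<epsilon>) l\<^esub> = 0"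
  by (simp add: coeff_def singleton_group_def)

lemma carrier_coeff_Ob:
  "carrier (Ob (coeff (ereal e)) l) = (if 0 \<le> l \<and> l \<le> e then UNIV else {0})"
  by (simp add: coeff_def)

lemma coeff_Ob_inside: "0 \<le> l \<Longrightarrow> l \<le> e \<Longrightarrow> Ob (coeff (ereal e)) l = integer_group"
  by (simp add: coeff_def)

lemma coend_data_coeff:
  assumes "ch_functor F"
  shows "coend_data F (coeff (ereal e))"
proof (rule coend_data.intro)
  fix l l' :: real assume "0 \<le> l" "l \<le> l'"
  then show "Ar (coeff (ereal e)) l l' \<in> hom (Ob (coeff (ereal e)) l') (Ob (coeff (ereal e)) l)"
    by (auto simp: coeff_def hom_def singleton_group_def)
qed (simp_all add: assms group_coeff_Ob)

lemma (in comm_group) int_pow_hom: "(\<lambda>x. x [^] (k::int)) \<in> hom G G"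
  by (rule homI) (simp_all add: int_pow_distrib)

locale coYoneda =
  fixes F :: "('g ch, int \<Rightarrow> 'g \<Rightarrow> 'g) diagram" and e :: real
  assumes chF: "ch_functor F" and e: "0 \<le> e"
begin

abbreviation "A \<equiv> coeff (ereal e)"

sublocale coend_data F A by (rule coend_data_coeff[OF chF])

text \<open>
  The value of the comparison map on \<open>x \<otimes> k\<close> at \<open>l\<close>. Beyond \<open>e\<close> there is no map
  \<open>F l \<rightarrow> F e\<close>, but there the coefficient group is trivial and the neutral element is the only choice.
\<close>

definition eval_gen :: "int \<Rightarrow> real \<Rightarrow> 'g \<Rightarrow> int \<Rightarrow> 'g" where
  "eval_gen n l x k = (if l \<le> e then Ar F l e n x [^]\<^bsub>grp (Ob F e) n\<^esub> k else \<one>\<^bsub>grp (Ob F e) n\<^esub>)"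

text \<open>
  Such a homomorphism exists by the universal property of the tensor product, and as pure tensors
  generate there is only one.
\<close>

definition eval_summand :: "int \<Rightarrow> real \<Rightarrow> ('g \<times> int \<Rightarrow>\<^sub>0 int) set \<Rightarrow> 'g" where
  "eval_summand n l = (SOME t. t \<in> hom (tensor (grp (Ob F l) n) (Ob A l)) (grp (Ob F e) n) \<and>
     (\<forall>x\<in>carrier (grp (Ob F l) n). \<forall>k\<in>carrier (Ob A l).
        t (tens (grp (Ob F l) n) (Ob A l) x k) = eval_gen n l x k))"

text \<open>
  Only the coordinate \<open>n\<close> of each summand is read, since the other ones lie in trivial groups.
\<close>

definition eval :: "int \<Rightarrow> (real \<Rightarrow> int \<Rightarrow> ('g \<times> int \<Rightarrow>\<^sub>0 int) set) \<Rightarrow> 'g" where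
  "eval n z = gfinprod (grp (Ob F e) n) (\<lambda>l. eval_summand n l (z l n)) {0..}"

lemma Fe_comm_group: "comm_group (grp (Ob F e) n)"
  using F_comm_group e by simp

lemma Fe_group: "group (grp (Ob F e) n)"
  using F_group e by simp

lemma
  assumes l: "0 \<le> l"
  shows eval_summand_hom: "eval_summand n l \<in> hom (tensor (grp (Ob F l) n) (Ob A l)) (grp (Ob F e) n)"
    and eval_summand_tens: "x \<in> carrier (grp (Ob F l) n) \<Longrightarrow> k \<in> carrier (Ob A l) \<Longrightarrow>
      eval_summand n l (tens (grp (Ob F l) n) (Ob A l) x k) = eval_gen n l x k"
proof -
  interpret E: comm_group "grp (Ob F e) n" by (rule Fe_comm_group)
  have "(\<lambda>x. eval_gen n l x k) \<in> hom (grp (Ob F l) n) (grp (Ob F e) n)" for k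
  proof (cases "l \<le> e")
    case True
    then show ?thesis
      using hom_compose[OF F_hom[OF l True, of n] E.int_pow_hom[of k]]
      by (simp add: eval_gen_def o_def)
  qed (simp add: eval_gen_def hom_def)
  moreover have "eval_gen n l x \<in> hom (Ob A l) (grp (Ob F e) n)" if x: "x \<in> carrier (grp (Ob F l) n)" for x
  proof (cases "l \<le> e")
    case True
    then show ?thesis
      using E.hom_integer_group_pow[OF hom_in_carrier[OF F_hom[OF l True] x]] l
      by (simp add: eval_gen_def[abs_def] coeff_Ob_inside)
  qed (simp add: eval_gen_def hom_def)
  ultimately have "\<exists>t\<in>hom (tensor (grp (Ob F l) n) (Ob A l)) (grp (Ob F e) n).
      \<forall>x\<in>carrier (grp (Ob F l) n). \<forall>k\<in>carrier (Ob A l).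
        t (tens (grp (Ob F l) n) (Ob A l) x k) = eval_gen n l x k"
    by (intro tensor_universal F_group l A_group Fe_comm_group)
  then have "eval_summand n l \<in> hom (tensor (grp (Ob F l) n) (Ob A l)) (grp (Ob F e) n) \<and>
     (\<forall>x\<in>carrier (grp (Ob F l) n). \<forall>k\<in>carrier (Ob A l).
        eval_summand n l (tens (grp (Ob F l) n) (Ob A l) x k) = eval_gen n l x k)"
    unfolding eval_summand_def Bex_def by (rule someI_ex)
  then show "eval_summand n l \<in> hom (tensor (grp (Ob F l) n) (Ob A l)) (grp (Ob F e) n)"
    and "x \<in> carrier (grp (Ob F l) n) \<Longrightarrow> k \<in> carrier (Ob A l) \<Longrightarrow>
      eval_summand n l (tens (grp (Ob F l) n) (Ob A l) x k) = eval_gen n l x k"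
    by auto
qed

lemma
  shows eval_hom: "eval n \<in> hom (grp (coend_target F A) n) (grp (Ob F e) n)"
    and eval_target_gen: "0 \<le> l \<Longrightarrow> x \<in> carrier (grp (Ob F l) n) \<Longrightarrow> k \<in> carrier (Ob A l) \<Longrightarrow>
      eval n (target_gen n l x k) = eval_gen n l x k"
proof -
  interpret E: comm_group "grp (Ob F e) n" by (rule Fe_comm_group)
  let ?G = "\<lambda>l. grp (coend_summand F A l l) n"
  have G: "group (?G l)" if "l \<in> {0..}" for l using that by (simp add: summand_group)
  have p: "(\<lambda>z. z n) \<in> hom (?G l) (tensor (grp (Ob F l) n) (Ob A l))" if l: "0 \<le> l" for l
  proof -
    have T: "group (tensor (grp (Ob F l) p) (grp (conc0 (Ob A l)) (n - p)))" for p
      by (intro group_tensor F_group l group_grp_conc0 A_group)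
    have z: "z p \<in> carrier (tensor (grp (Ob F l) p) (grp (conc0 (Ob A l)) (n - p)))"
      if "z \<in> carrier (?G l)" for z p
      using that unfolding coend_summand_def grp_ch_tensor by (auto simp: carrier_sum_group T)
    show ?thesis
      by (rule homI) (use z[of _ n] in \<open>simp_all add: coend_summand_def grp_ch_tensor\<close>)
  qed
  have f: "(\<lambda>z. eval_summand n l (z n)) \<in> hom (?G l) (grp (Ob F e) n)" if "l \<in> {0..}" for l
    using hom_compose[OF p eval_summand_hom] that by (simp add: o_def)
  show "eval n \<in> hom (grp (coend_target F A) n) (grp (Ob F e) n)"
    unfolding eval_def[abs_def] grp_target by (rule E.hom_group_sum[OF f G])
  assume l: "0 \<le> l" and xk: "x \<in> carrier (grp (Ob F l) n)" "k \<in> carrier (Ob A l)"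
  have pc: "pure_tensor (Ob F l) (Ob A l) n x k \<in> carrier (?G l)"
    unfolding coend_summand_def by (rule pure_tensor_closed) (use l xk F_group A_group in auto)
  have "eval n (target_gen n l x k) = eval_summand n l (pure_tensor (Ob F l) (Ob A l) n x k n)"
    unfolding eval_def target_gen_def
    by (rule gfinprod_incl[of _ "{0..}" ?G "\<lambda>l z. eval_summand n l (z n)" l, OF E.comm_group_axioms G f _ pc])
       (use l in auto)
  then show "eval n (target_gen n l x k) = eval_gen n l x k"
    by (simp add: pure_tensor_def sum_incl_def eval_summand_tens l xk)
qed

lemma eval_group_hom: "group_hom (grp (coend_target F A) n) (grp (Ob F e) n) (eval n)"
  using eval_hom target_group Fe_group by (simp add: group_hom_def group_hom_axioms_def)

lemma eval_section:
  assumes "y \<in> carrier (grp (Ob F e) n)"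
  shows "eval n (target_gen n e y 1) = y"
  using assms e group.int_pow_1[OF Fe_group assms]
  by (simp add: eval_target_gen carrier_coeff_Ob eval_gen_def F_id)

lemma eval_surj: "eval n ` carrier (grp (coend_target F A) n) = carrier (grp (Ob F e) n)"
proof
  show "eval n ` carrier (grp (coend_target F A) n) \<subseteq> carrier (grp (Ob F e) n)"
    using hom_in_carrier[OF eval_hom] by blast
  show "carrier (grp (Ob F e) n) \<subseteq> eval n ` carrier (grp (coend_target F A) n)"
  proof
    fix y assume y: "y \<in> carrier (grp (Ob F e) n)"
    moreover have "target_gen n e y 1 \<in> carrier (grp (coend_target F A) n)"
      using e y by (intro target_gen_closed) (auto simp: carrier_coeff_Ob)
    ultimately show "y \<in> eval n ` carrier (grp (coend_target F A) n)"
      using eval_section by (intro image_eqI[of _ _ "target_gen n e y 1"]) auto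
  qed
qed

text \<open>
  On the generator \<open>x \<otimes> k\<close> at \<open>(l, l')\<close> this is functoriality of \<open>F\<close> along
  \<open>l \<le> l' \<le> e\<close>. For \<open>l' > e\<close> both sides are neutral, either because the index is too large or because
  \<open>k\<close> is sent to zero.
\<close>

lemma eval_cov_contra:
  assumes z: "z \<in> carrier (grp (coend_source F A) n)"
  shows "eval n (coend_cov F A n z) = eval n (coend_contra F A n z)"
proof -
  have "(eval n \<circ> coend_cov F A n) z = (eval n \<circ> coend_contra F A n) z"
  proof (rule hom_eq_on_generators[OF source_group Fe_group _ _ source_generated _ z])
    show "eval n \<circ> coend_cov F A n \<in> hom (grp (coend_source F A) n) (grp (Ob F e) n)"
      by (rule hom_compose[OF cov_hom eval_hom])
    show "eval n \<circ> coend_contra F A n \<in> hom (grp (coend_source F A) n) (grp (Ob F e) n)"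
      by (rule hom_compose[OF contra_hom eval_hom])
    fix s assume "s \<in> {source_gen n l l' x k | l l' x k.
        0 \<le> l \<and> l \<le> l' \<and> x \<in> carrier (grp (Ob F l) n) \<and> k \<in> carrier (Ob A l')}"
    then obtain l l' x k where s: "s = source_gen n l l' x k" and l: "0 \<le> l" "l \<le> l'"
      and xk: "x \<in> carrier (grp (Ob F l) n)" "k \<in> carrier (Ob A l')" by blast
    have "eval n (coend_cov F A n s) = eval_gen n l' (Ar F l l' n x) k"
      using l xk hom_in_carrier[OF F_hom] unfolding s by (simp add: cov_gen eval_target_gen)
    moreover have "eval n (coend_contra F A n s) = eval_gen n l x (Ar A l l' k)"
      using l xk hom_in_carrier[OF A_hom] unfolding s by (simp add: contra_gen eval_target_gen)
    moreover have "eval_gen n l' (Ar F l l' n x) k = eval_gen n l x (Ar A l l' k)"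
    proof (cases "l' \<le> e")
      case True
      then show ?thesis using l xk by (simp add: eval_gen_def F_comp coeff_def)
    next
      case False
      then show ?thesis using l by (simp add: eval_gen_def coeff_def)
    qed
    ultimately show "(eval n \<circ> coend_cov F A n) s = (eval n \<circ> coend_contra F A n) s" by simp
  qed
  then show ?thesis by simp
qed

text \<open>
  At the index \<open>e\<close> the coefficient \<open>k\<close> is \<open>k\<close> times \<open>1\<close> and can be moved across the tensor
  product.
\<close>

lemma target_gen_pow:
  assumes "x \<in> carrier (grp (Ob F e) n)"
  shows "target_gen n e x k = target_gen n e (x [^]\<^bsub>grp (Ob F e) n\<^esub> k) 1"
proof -
  have A: "Ob A e = integer_group" using e by (simp add: coeff_Ob_inside)
  have "target_gen n e x (1 [^]\<^bsub>integer_group\<^esub> k) = target_gen n e x 1 [^]\<^bsub>grp (coend_target F A) n\<^esub> k"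
    by (rule hom_int_pow[OF target_gen_hom_right[OF e assms, unfolded A]]) (simp_all add: target_group)
  moreover have "target_gen n e (x [^]\<^bsub>grp (Ob F e) n\<^esub> k) 1 = target_gen n e x 1 [^]\<^bsub>grp (coend_target F A) n\<^esub> k"
    by (rule hom_int_pow[OF target_gen_hom_left[OF e] assms Fe_group target_group]) (simp add: A)
  ultimately show ?thesis by simp
qed

text \<open>
  The heart of the co-Yoneda lemma: modulo the relations, everything can be pushed to the index \<open>e\<close>.
  Both sides are homomorphisms in \<open>z\<close>, so it suffices to treat a generator.
\<close>

lemma coset_eval:
  assumes z: "z \<in> carrier (grp (coend_target F A) n)"
  shows "rels n #>\<^bsub>grp (coend_target F A) n\<^esub> z = rels n #>\<^bsub>grp (coend_target F A) n\<^esub> target_gen n e (eval n z) 1"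
proof -
  let ?T = "grp (coend_target F A) n"
  interpret T: comm_group ?T by (rule target_comm_group)
  interpret N: normal "rels n" ?T by (rule T.subgroup_imp_normal[OF rels_subgroup])
  have Q: "group (?T Mod rels n)" by (rule N.factorgroup_is_group)
  have one: "1 \<in> carrier (Ob A e)" using e by (simp add: carrier_coeff_Ob)
  have "(\<lambda>a. rels n #>\<^bsub>?T\<^esub> a) z = ((\<lambda>a. rels n #>\<^bsub>?T\<^esub> a) \<circ> ((\<lambda>y. target_gen n e y 1) \<circ> eval n)) z"
  proof (rule hom_eq_on_generators[OF target_group Q _ _ target_generated _ z])
    show "(\<lambda>a. rels n #>\<^bsub>?T\<^esub> a) \<in> hom ?T (?T Mod rels n)" by (rule N.r_coset_hom_Mod)
    show "(\<lambda>a. rels n #>\<^bsub>?T\<^esub> a) \<circ> ((\<lambda>y. target_gen n e y 1) \<circ> eval n) \<in> hom ?T (?T Mod rels n)"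
      by (rule hom_compose[OF hom_compose[OF eval_hom target_gen_hom_left[OF e one]] N.r_coset_hom_Mod])
    fix s assume "s \<in> {target_gen n l x k | l x k. 0 \<le> l \<and> x \<in> carrier (grp (Ob F l) n) \<and> k \<in> carrier (Ob A l)}"
    then obtain l x k where s: "s = target_gen n l x k" and l: "0 \<le> l"
      and xk: "x \<in> carrier (grp (Ob F l) n)" "k \<in> carrier (Ob A l)" by blast
    have sc: "s \<in> carrier ?T" unfolding s by (rule target_gen_closed[OF l xk])
    show "rels n #>\<^bsub>?T\<^esub> s = ((\<lambda>a. rels n #>\<^bsub>?T\<^esub> a) \<circ> ((\<lambda>y. target_gen n e y 1) \<circ> eval n)) s"
    proof (cases "l \<le> e")
      case True
      \<comment> \<open>The relation indexed by \<open>l \<le> e\<close> identifies \<open>x \<otimes> k\<close> at \<open>l\<close> with \<open>F (l \<le> e) x \<otimes> k\<close> at \<open>e\<close>;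
        \<open>k\<close> is a legitimate coefficient there because \<open>e\<close> itself lies in \<open>[0, e]\<close>.\<close>
      let ?w = "source_gen n l e x k"
      have k: "k \<in> carrier (Ob A e)" using e by (simp add: carrier_coeff_Ob)
      have w: "?w \<in> carrier (grp (coend_source F A) n)" by (rule source_gen_closed[OF l True xk(1) k])
      have Fx: "Ar F l e n x \<in> carrier (grp (Ob F e) n)" by (rule hom_in_carrier[OF F_hom[OF l True] xk(1)])
      have "coend_contra F A n ?w = s"
        using contra_gen[OF l True xk(1) k] l True e by (simp add: s coeff_def)
      moreover have "coend_cov F A n ?w = target_gen n e (eval n s) 1"
        using cov_gen[OF l True xk(1) k] target_gen_pow[OF Fx, of k] l True xk
        by (simp add: s eval_target_gen eval_gen_def)
      ultimately have "target_gen n e (eval n s) 1 \<otimes>\<^bsub>?T\<^esub> inv\<^bsub>?T\<^esub> s \<in> rels n"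
        using w unfolding coeq_rels_def by (metis (no_types, lifting) image_eqI)
      moreover have tc: "target_gen n e (eval n s) 1 \<in> carrier ?T"
        by (rule target_gen_closed[OF e hom_in_carrier[OF eval_hom sc] one])
      ultimately have "target_gen n e (eval n s) 1 \<in> rels n #>\<^bsub>?T\<^esub> s"
        using N.rcos_module_rev[OF T.is_group sc tc] by blast
      then show ?thesis using T.repr_independence[OF _ sc rels_subgroup] by simp
    next
      case False
      then have "k = \<one>\<^bsub>Ob A l\<^esub>" using xk l by (simp add: carrier_coeff_Ob)
      then have s1: "s = \<one>\<^bsub>?T\<^esub>" using target_gen_one[OF l xk(1)] s by simp
      have "target_gen n e (eval n s) 1 = \<one>\<^bsub>?T\<^esub>"
        unfolding s1 hom_one[OF eval_hom target_group Fe_group]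
        by (rule hom_one[OF target_gen_hom_left[OF e one] Fe_group target_group])
      then show ?thesis using s1 by simp
    qed
  qed
  then show ?thesis by simp
qed

text \<open>
  If \<open>z\<close> is killed, then the section applied to its image is neutral, so \<open>coset_eval\<close> places
  \<open>z\<close> in the coset of the neutral element.
\<close>

lemma kernel_eval: "kernel (grp (coend_target F A) n) (grp (Ob F e) n) (eval n) = rels n"
proof
  let ?T = "grp (coend_target F A) n"
  interpret T: comm_group ?T by (rule target_comm_group)
  interpret h: group_hom ?T "grp (Ob F e) n" "eval n" by (rule eval_group_hom)
  show "rels n \<subseteq> kernel ?T (grp (Ob F e) n) (eval n)"
  proof
    fix a assume "a \<in> rels n"
    then obtain w where w: "w \<in> carrier (grp (coend_source F A) n)"
      and a: "a = coend_cov F A n w \<otimes>\<^bsub>?T\<^esub> inv\<^bsub>?T\<^esub> coend_contra F A n w"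
      by (auto simp: coeq_rels_def)
    have "coend_cov F A n w \<in> carrier ?T" "coend_contra F A n w \<in> carrier ?T"
      using hom_in_carrier[OF cov_hom w] hom_in_carrier[OF contra_hom w] by auto
    then show "a \<in> kernel ?T (grp (Ob F e) n) (eval n)"
      using eval_cov_contra[OF w] by (simp add: a kernel_def)
  qed
  show "kernel ?T (grp (Ob F e) n) (eval n) \<subseteq> rels n"
  proof
    fix z assume "z \<in> kernel ?T (grp (Ob F e) n) (eval n)"
    then have z: "z \<in> carrier ?T" "eval n z = \<one>\<^bsub>grp (Ob F e) n\<^esub>" by (auto simp: kernel_def)
    have one: "1 \<in> carrier (Ob A e)" using e by (simp add: carrier_coeff_Ob)
    have "target_gen n e (eval n z) 1 = \<one>\<^bsub>?T\<^esub>"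
      unfolding z(2) by (rule hom_one[OF target_gen_hom_left[OF e one] Fe_group target_group])
    then have "rels n #>\<^bsub>?T\<^esub> z = rels n"
      using coset_eval[OF z(1)] subgroup.subset[OF rels_subgroup] by simp
    then show "z \<in> rels n" using T.rcos_self[OF z(1) rels_subgroup] by simp
  qed
qed

lemma eval_bd:
  assumes z: "z \<in> carrier (grp (coend_target F A) n)"
  shows "eval (n - 1) (bd (coend_target F A) n z) = bd (Ob F e) n (eval n z)"
proof -
  have "(eval (n - 1) \<circ> bd (coend_target F A) n) z = (bd (Ob F e) n \<circ> eval n) z"
  proof (rule hom_eq_on_generators[OF target_group Fe_group _ _ target_generated _ z])
    show "eval (n - 1) \<circ> bd (coend_target F A) n \<in> hom (grp (coend_target F A) n) (grp (Ob F e) (n - 1))"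
      by (rule hom_compose[OF target_bd_hom eval_hom])
    show "bd (Ob F e) n \<circ> eval n \<in> hom (grp (coend_target F A) n) (grp (Ob F e) (n - 1))"
      by (rule hom_compose[OF eval_hom F_bd[OF e]])
    fix s assume "s \<in> {target_gen n l x k | l x k. 0 \<le> l \<and> x \<in> carrier (grp (Ob F l) n) \<and> k \<in> carrier (Ob A l)}"
    then obtain l x k where s: "s = target_gen n l x k" and l: "0 \<le> l"
      and xk: "x \<in> carrier (grp (Ob F l) n)" "k \<in> carrier (Ob A l)" by blast
    have bx: "bd (Ob F l) n x \<in> carrier (grp (Ob F l) (n - 1))" by (rule hom_in_carrier[OF F_bd[OF l] xk(1)])
    have "eval_gen (n - 1) l (bd (Ob F l) n x) k = bd (Ob F e) n (eval_gen n l x k)"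
    proof (cases "l \<le> e")
      case True
      have Fx: "Ar F l e n x \<in> carrier (grp (Ob F e) n)" by (rule hom_in_carrier[OF F_hom[OF l True] xk(1)])
      show ?thesis
        using True l xk hom_int_pow[OF F_bd[OF e] Fx Fe_group Fe_group, of k]
        by (simp add: eval_gen_def F_chain)
    next
      case False
      then show ?thesis using hom_one[OF F_bd[OF e] Fe_group Fe_group] by (simp add: eval_gen_def)
    qed
    then show "(eval (n - 1) \<circ> bd (coend_target F A) n) s = (bd (Ob F e) n \<circ> eval n) s"
      by (simp add: s target_bd_gen eval_target_gen l xk bx)
  qed
  then show ?thesis by simp
qed

definition coYoneda_map :: "int \<Rightarrow> (real \<Rightarrow> int \<Rightarrow> ('g \<times> int \<Rightarrow>\<^sub>0 int) set) set \<Rightarrow> 'g" where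
  "coYoneda_map n S = the_elem (eval n ` S)"

lemma grp_coend: "grp (coend F A) n = grp (coend_target F A) n Mod rels n"
  by (simp add: coend_def ch_coeq_def)

lemma bd_coend: "bd (coend F A) n = quot_map (grp (coend_target F A) (n - 1)) (rels (n - 1)) (bd (coend_target F A) n)"
  by (simp add: coend_def ch_coeq_def)

lemma coYoneda_map_iso: "coYoneda_map n \<in> iso (grp (coend F A) n) (grp (Ob F e) n)"
  using group_hom.FactGroup_iso_set[OF eval_group_hom eval_surj]
  by (simp add: grp_coend kernel_eval coYoneda_map_def[abs_def])

lemma comm_group_coend: "comm_group (grp (coend F A) n)"
  unfolding grp_coend by (rule comm_group.abelian_FactGroup[OF target_comm_group rels_subgroup])

lemma
  assumes S: "S \<in> carrier (grp (coend F A) n)"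
  shows bd_coend_closed: "bd (coend F A) n S \<in> carrier (grp (coend F A) (n - 1))"
    and coYoneda_map_bd: "coYoneda_map (n - 1) (bd (coend F A) n S) = bd (Ob F e) n (coYoneda_map n S)"
  using quot_map_kernel[where f = "bd (coend_target F A) n" and u = "bd (Ob F e) n",
      OF eval_group_hom[of n] eval_group_hom[of "n - 1"] hom_in_carrier[OF target_bd_hom] eval_bd, of S] S
  by (simp_all add: grp_coend kernel_eval coYoneda_map_def bd_coend)

end

text \<open>
  Naturality in \<open>e\<close>. On generators it says that \<open>F (l \<le> e')\<close> is \<open>F (l \<le> e)\<close> followed by
  \<open>F (e \<le> e')\<close>, when \<open>l \<le> e\<close>; a generator with \<open>e < l\<close> has coefficient zero.
\<close>

lemma
  assumes F: "ch_functor F" and e: "0 \<le> e" "e \<le> e'"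
    and S: "S \<in> carrier (grp (coend F (coeff (ereal e))) n)"
  shows coend_map_closed: "coend_map F (coeff (ereal e')) (coeff_trans (ereal e)) n S
      \<in> carrier (grp (coend F (coeff (ereal e'))) n)"
    and coYoneda_map_natural: "coYoneda.coYoneda_map F e' n
      (coend_map F (coeff (ereal e')) (coeff_trans (ereal e)) n S)
      = Ar F e e' n (coYoneda.coYoneda_map F e n S)"
proof -
  interpret E: coYoneda F e using F e by unfold_locales auto
  interpret E': coYoneda F e' using F e by unfold_locales auto
  interpret t: coend_transformation F "coeff (ereal e)" "coeff (ereal e')" "coeff_trans (ereal e)"
  proof
    fix l :: real assume l: "0 \<le> l"
    show "coeff_trans (ereal e) l \<in> hom (Ob (coeff (ereal e)) l) (Ob (coeff (ereal e')) l)"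
      using l e by (auto simp: coeff_trans_def[abs_def] coeff_def hom_def singleton_group_def)
  qed
  have ev: "E'.eval n (t.target_map n z) = Ar F e e' n (E.eval n z)"
    if z: "z \<in> carrier (grp (coend_target F (coeff (ereal e))) n)" for z
  proof -
    have "(E'.eval n \<circ> t.target_map n) z = (Ar F e e' n \<circ> E.eval n) z"
    proof (rule hom_eq_on_generators[OF E.target_group E'.Fe_group _ _ E.target_generated _ z])
      show "E'.eval n \<circ> t.target_map n \<in> hom (grp (coend_target F (coeff (ereal e))) n) (grp (Ob F e') n)"
        by (rule hom_compose[OF t.target_map_hom E'.eval_hom])
      show "Ar F e e' n \<circ> E.eval n \<in> hom (grp (coend_target F (coeff (ereal e))) n) (grp (Ob F e') n)"
        by (rule hom_compose[OF E.eval_hom E.F_hom[OF e]])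
      fix s assume "s \<in> {E.target_gen n l x k | l x k. 0 \<le> l \<and> x \<in> carrier (grp (Ob F l) n) \<and>
          k \<in> carrier (Ob (coeff (ereal e)) l)}"
      then obtain l x k where s: "s = E.target_gen n l x k" and l: "0 \<le> l"
        and xk: "x \<in> carrier (grp (Ob F l) n)" "k \<in> carrier (Ob (coeff (ereal e)) l)" by blast
      have tk: "coeff_trans (ereal e) l k \<in> carrier (Ob (coeff (ereal e')) l)"
        by (rule hom_in_carrier[OF t.\<tau>[OF l] xk(2)])
      have "E'.eval_gen n l x (coeff_trans (ereal e) l k) = Ar F e e' n (E.eval_gen n l x k)"
      proof (cases "l \<le> e")
        case True
        have Fx: "Ar F l e n x \<in> carrier (grp (Ob F e) n)"
          by (rule hom_in_carrier[OF E.F_hom[OF l True] xk(1)])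
        show ?thesis
          using True l xk e hom_int_pow[OF E.F_hom[OF e] Fx E.Fe_group E'.Fe_group, of k]
          by (simp add: E.eval_gen_def E'.eval_gen_def coeff_trans_def E.F_comp)
      next
        case False
        then show ?thesis
          using hom_one[OF E.F_hom[OF e] E.Fe_group E'.Fe_group]
          by (simp add: E.eval_gen_def E'.eval_gen_def coeff_trans_def)
      qed
      then show "(E'.eval n \<circ> t.target_map n) s = (Ar F e e' n \<circ> E.eval n) s"
        by (simp add: s t.target_map_gen E.eval_target_gen E'.eval_target_gen l xk tk)
    qed
    then show ?thesis by simp
  qed
  note q = quot_map_kernel[where f = "t.target_map n" and u = "Ar F e e' n",
      OF E.eval_group_hom[of n] E'.eval_group_hom[of n] hom_in_carrier[OF t.target_map_hom] ev, of S]
  have S': "S \<in> carrier (grp (coend_target F (coeff (ereal e))) n Mod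
      kernel (grp (coend_target F (coeff (ereal e))) n) (grp (Ob F e) n) (E.eval n))"
    using S by (simp add: E.grp_coend E.kernel_eval)
  show "coend_map F (coeff (ereal e')) (coeff_trans (ereal e)) n S
      \<in> carrier (grp (coend F (coeff (ereal e'))) n)"
    using q(1)[OF _ _ S'] by (simp add: t.coend_map_eq E'.grp_coend E'.kernel_eval)
  show "E'.coYoneda_map n (coend_map F (coeff (ereal e')) (coeff_trans (ereal e)) n S)
      = Ar F e e' n (E.coYoneda_map n S)"
    using q(2)[OF _ _ S'] by (simp add: t.coend_map_eq E.coYoneda_map_def E'.coYoneda_map_def E'.kernel_eval)
qed

section \<open>Transport of functors along isomorphisms\<close>

text \<open>
  Every functor law for \<open>F\<close>, including additivity of its maps and \<open>\<partial> \<circ> \<partial> = 0\<close>, is an equation in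
  some \<open>F e\<close>. It can be checked after applying the injective \<open>\<eta> e\<close>, where it becomes the
  corresponding law for \<open>G\<close>. So no law for coends has to be verified directly.
\<close>

lemma ch_naturally_isomorphic_transport:
  assumes G: "ch_functor G"
    and grp: "\<And>e n. 0 \<le> e \<Longrightarrow> comm_group (grp (Ob F e) n)"
    and iso: "\<And>e n. 0 \<le> e \<Longrightarrow> \<eta> e n \<in> iso (grp (Ob F e) n) (grp (Ob G e) n)"
    and bd: "\<And>e n x. 0 \<le> e \<Longrightarrow> x \<in> carrier (grp (Ob F e) n) \<Longrightarrow>
        bd (Ob F e) n x \<in> carrier (grp (Ob F e) (n - 1)) \<and>
        \<eta> e (n - 1) (bd (Ob F e) n x) = bd (Ob G e) n (\<eta> e n x)"
    and Ar: "\<And>e e' n x. 0 \<le> e \<Longrightarrow> e \<le> e' \<Longrightarrow> x \<in> carrier (grp (Ob F e) n) \<Longrightarrow>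
        Ar F e e' n x \<in> carrier (grp (Ob F e') n) \<and>
        \<eta> e' n (Ar F e e' n x) = Ar G e e' n (\<eta> e n x)"
  shows "ch_naturally_isomorphic F G"
proof -
  have grp': "group (grp (Ob F e) n)" if "0 \<le> e" for e n
    using grp[OF that] by (simp add: comm_group_def)
  have Gc: "comm_group (grp (Ob G e) n)" "bd (Ob G e) n \<in> hom (grp (Ob G e) n) (grp (Ob G e) (n - 1))"
      "x \<in> carrier (grp (Ob G e) n) \<Longrightarrow> bd (Ob G e) (n - 1) (bd (Ob G e) n x) = \<one>\<^bsub>grp (Ob G e) (n - 2)\<^esub>"
      "x \<in> carrier (grp (Ob G e) n) \<Longrightarrow> Ar G e e n x = x"
    if "0 \<le> e" for e n x
    using G that by (auto simp: ch_functor_def is_chain_complex_def)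
  have Ga: "Ar G e e' n \<in> hom (grp (Ob G e) n) (grp (Ob G e') n)"
      "x \<in> carrier (grp (Ob G e) n) \<Longrightarrow> Ar G e e' (n - 1) (bd (Ob G e) n x) = bd (Ob G e') n (Ar G e e' n x)"
    if "0 \<le> e" "e \<le> e'" for e e' n x
    using G that by (auto simp: ch_functor_def is_chain_map_def)
  have Gcomp: "Ar G e' e'' n (Ar G e e' n x) = Ar G e e'' n x"
    if "0 \<le> e" "e \<le> e'" "e' \<le> e''" "x \<in> carrier (grp (Ob G e) n)" for e e' e'' n x
    using G that by (auto simp: ch_functor_def)
  have hom: "\<eta> e n \<in> hom (grp (Ob F e) n) (grp (Ob G e) n)" if "0 \<le> e" for e n
    using iso[OF that] by (auto simp: iso_def)
  have inj: "x = y" if "0 \<le> e" "x \<in> carrier (grp (Ob F e) n)" "y \<in> carrier (grp (Ob F e) n)"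
      "\<eta> e n x = \<eta> e n y" for e n x y
    using iso[OF that(1), of n] that by (auto simp: iso_def bij_betw_def inj_on_def)
  have cl: "\<eta> e n x \<in> carrier (grp (Ob G e) n)" if "0 \<le> e" "x \<in> carrier (grp (Ob F e) n)" for e n x
    using hom_in_carrier[OF hom] that by blast
  have mult: "x \<otimes>\<^bsub>grp (Ob F e) n\<^esub> y \<in> carrier (grp (Ob F e) n)"
    if "0 \<le> e" "x \<in> carrier (grp (Ob F e) n)" "y \<in> carrier (grp (Ob F e) n)" for e n x y
    using grp'[OF that(1)] that by (simp add: group.is_monoid monoid.m_closed)
  have bdF: "bd (Ob F e) n \<in> hom (grp (Ob F e) n) (grp (Ob F e) (n - 1))" if e: "0 \<le> e" for e n
  proof (rule homI)
    fix x y assume xy: "x \<in> carrier (grp (Ob F e) n)" "y \<in> carrier (grp (Ob F e) n)"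
    show "bd (Ob F e) n (x \<otimes>\<^bsub>grp (Ob F e) n\<^esub> y) =
        bd (Ob F e) n x \<otimes>\<^bsub>grp (Ob F e) (n - 1)\<^esub> bd (Ob F e) n y"
      by (rule inj[OF e, where n = "n - 1"])
         (use e xy in \<open>simp_all add: bd mult cl hom_mult[OF hom] hom_mult[OF Gc(2)]\<close>)
  qed (use bd e in blast)
  have ArF: "Ar F e e' n \<in> hom (grp (Ob F e) n) (grp (Ob F e') n)" if e: "0 \<le> e" "e \<le> e'" for e e' n
  proof (rule homI)
    fix x y assume xy: "x \<in> carrier (grp (Ob F e) n)" "y \<in> carrier (grp (Ob F e) n)"
    have e': "0 \<le> e'" using e by simp
    show "Ar F e e' n (x \<otimes>\<^bsub>grp (Ob F e) n\<^esub> y) = Ar F e e' n x \<otimes>\<^bsub>grp (Ob F e') n\<^esub> Ar F e e' n y"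
      by (rule inj[OF e', where n = n])
         (use e e' xy in \<open>simp_all add: Ar mult cl hom_mult[OF hom] hom_mult[OF Ga(1)]\<close>)
  qed (use Ar e in blast)
  have cpx: "is_chain_complex (Ob F e)" if e: "0 \<le> e" for e
    unfolding is_chain_complex_def
  proof (intro conjI allI ballI)
    fix n x assume x: "x \<in> carrier (grp (Ob F e) n)"
    have b: "bd (Ob F e) n x \<in> carrier (grp (Ob F e) (n - 1))" using bd[OF e x] by simp
    have n2: "n - 1 - 1 = n - 2" by simp
    have c: "bd (Ob F e) (n - 1) (bd (Ob F e) n x) \<in> carrier (grp (Ob F e) (n - 2))"
      and "\<eta> e (n - 2) (bd (Ob F e) (n - 1) (bd (Ob F e) n x)) = bd (Ob G e) (n - 1) (\<eta> e (n - 1) (bd (Ob F e) n x))"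
      using bd[OF e b] unfolding n2 by auto
    then have "\<eta> e (n - 2) (bd (Ob F e) (n - 1) (bd (Ob F e) n x)) = \<one>\<^bsub>grp (Ob G e) (n - 2)\<^esub>"
      using Gc(3)[OF e cl[OF e x]] bd[OF e x] by simp
    also have "\<dots> = \<eta> e (n - 2) \<one>\<^bsub>grp (Ob F e) (n - 2)\<^esub>"
      using hom_one[OF hom[OF e] grp'[OF e]] Gc(1)[OF e] by (simp add: comm_group_def)
    finally show "bd (Ob F e) (n - 1) (bd (Ob F e) n x) = \<one>\<^bsub>grp (Ob F e) (n - 2)\<^esub>"
      using inj[OF e c] grp'[OF e] by (simp add: group.is_monoid monoid.one_closed)
  qed (use grp bdF e in auto)
  have map: "is_chain_map (Ob F e) (Ob F e') (Ar F e e')" if e: "0 \<le> e" "e \<le> e'" for e e'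
    unfolding is_chain_map_def
  proof (intro conjI allI ballI)
    fix n x assume x: "x \<in> carrier (grp (Ob F e) n)"
    have e': "0 \<le> e'" using e by simp
    show "Ar F e e' (n - 1) (bd (Ob F e) n x) = bd (Ob F e') n (Ar F e e' n x)"
      by (rule inj[OF e', where n = "n - 1"]) (use e e' x in \<open>simp_all add: Ar bd Ga cl\<close>)
  qed (use ArF e in auto)
  have id: "Ar F e e n x = x" if "0 \<le> e" "x \<in> carrier (grp (Ob F e) n)" for e n x
    by (rule inj[OF that(1), where n = n]) (use that in \<open>simp_all add: Ar Gc cl\<close>)
  have comp: "Ar F e' e'' n (Ar F e e' n x) = Ar F e e'' n x"
    if e: "0 \<le> e" "e \<le> e'" "e' \<le> e''" and x: "x \<in> carrier (grp (Ob F e) n)" for e e' e'' n x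
  proof -
    have e'': "0 \<le> e''" "0 \<le> e'" "e \<le> e''" using e by auto
    show ?thesis by (rule inj[OF e''(1), where n = n]) (use e e'' x in \<open>simp_all add: Ar Gcomp cl\<close>)
  qed
  have "ch_functor F" unfolding ch_functor_def using cpx map id comp by blast
  moreover have "is_chain_iso (Ob F e) (Ob G e) (\<eta> e)" if "0 \<le> e" for e
    using iso hom bd that by (auto simp: is_chain_iso_def is_chain_map_def)
  ultimately show ?thesis
    unfolding ch_naturally_isomorphic_def using G Ar by blast
qed

text \<open>
  This is the co-Yoneda lemma, since \<open>coeff (ereal e)\<close> is the free abelian group on the contravariant
  functor represented by \<open>e\<close>.
\<close>

theorem coend_coeff_naturally_isomorphic:
  assumes F: "ch_functor F"
  shows "ch_naturally_isomorphic
    \<lparr>Ob = (\<lambda>e. coend F (coeff (ereal e))),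
     Ar = (\<lambda>e e'. coend_map F (coeff (ereal e')) (coeff_trans (ereal e)))\<rparr> F"
proof (rule ch_naturally_isomorphic_transport[where \<eta> = "coYoneda.coYoneda_map F"])
  fix e :: real and n assume "0 \<le> e"
  then interpret coYoneda F e using F by unfold_locales
  let ?C = "\<lparr>Ob = (\<lambda>e. coend F (coeff (ereal e))),
     Ar = (\<lambda>e e'. coend_map F (coeff (ereal e')) (coeff_trans (ereal e)))\<rparr>"
  show "comm_group (grp (Ob ?C e) n)" using comm_group_coend by simp
  show "coYoneda_map n \<in> iso (grp (Ob ?C e) n) (grp (Ob F e) n)" using coYoneda_map_iso by simp
  show "bd (Ob ?C e) n x \<in> carrier (grp (Ob ?C e) (n - 1)) \<and>
      coYoneda_map (n - 1) (bd (Ob ?C e) n x) = bd (Ob F e) n (coYoneda_map n x)"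
    if "x \<in> carrier (grp (Ob ?C e) n)" for x
    using that bd_coend_closed coYoneda_map_bd by simp
qed (use F coend_map_closed coYoneda_map_natural in auto)

section \<open>Homology and natural isomorphisms\<close>

context
  fixes C :: "'g ch"
  assumes C: "is_chain_complex C"
begin

lemma chain_complex_comm_group: "comm_group (grp C n)"
  using C by (simp add: is_chain_complex_def)

lemma chain_complex_bd_group_hom: "group_hom (grp C n) (grp C (n - 1)) (bd C n)"
  using C by (simp add: is_chain_complex_def group_hom_def group_hom_axioms_def comm_group_def)

lemma carrier_cycles: "carrier (cycles C n) = {x \<in> carrier (grp C n). bd C n x = \<one>\<^bsub>grp C (n - 1)\<^esub>}"
  unfolding cycles_def
  using subgroup.carrier_subgroup_generated_subgroup[OF group_hom.subgroup_kernel[OF chain_complex_bd_group_hom]]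
  by (simp add: kernel_def)

lemma comm_group_cycles: "comm_group (cycles C n)"
proof -
  interpret comm_group "grp C n" by (rule chain_complex_comm_group)
  show ?thesis unfolding cycles_def by (rule abelian_subgroup_generated[OF comm_group_axioms])
qed

lemma boundaries_subgroup: "subgroup (boundaries C n) (cycles C n)"
proof -
  interpret h: group_hom "grp C (n + 1)" "grp C (n + 1 - 1)" "bd C (n + 1)"
    by (rule chain_complex_bd_group_hom)
  interpret comm_group "grp C n" by (rule chain_complex_comm_group)
  have n: "n + 1 - 1 = n" "n + 1 - 2 = n - 1" by simp_all
  have "subgroup (boundaries C n) (grp C n)"
    using h.img_is_subgroup by (simp add: boundaries_def n)
  moreover have "bd C (n + 1 - 1) (bd C (n + 1) x) = \<one>\<^bsub>grp C (n + 1 - 2)\<^esub>" if "x \<in> carrier (grp C (n + 1))" for x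
    using C that by (simp only: is_chain_complex_def)
  then have "boundaries C n \<subseteq> carrier (cycles C n)"
    unfolding carrier_cycles boundaries_def n using h.hom_closed[unfolded n] by auto
  ultimately show ?thesis
    unfolding cycles_def by (simp add: subgroup_subgroup_generated_iff)
qed

lemma boundaries_normal: "boundaries C n \<lhd> cycles C n"
  using comm_group.subgroup_imp_normal[OF comm_group_cycles boundaries_subgroup] .

lemma comm_group_homology: "comm_group (homology n C)"
  unfolding homology_def by (rule comm_group.abelian_FactGroup[OF comm_group_cycles boundaries_subgroup])

lemma carrier_homology:
  "carrier (homology n C) = (\<lambda>x. boundaries C n #>\<^bsub>cycles C n\<^esub> x) ` carrier (cycles C n)"
  by (simp add: homology_def carrier_FactGroup)

end

context
  fixes C :: "'g ch" and D :: "'h ch" and f :: "int \<Rightarrow> 'g \<Rightarrow> 'h"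
  assumes C: "is_chain_complex C" and D: "is_chain_complex D" and f: "is_chain_map C D f"
begin

lemma chain_map_closed: "x \<in> carrier (grp C n) \<Longrightarrow> f n x \<in> carrier (grp D n)"
  using f by (auto simp: is_chain_map_def hom_def)

lemma chain_map_bd: "x \<in> carrier (grp C n) \<Longrightarrow> f (n - 1) (bd C n x) = bd D n (f n x)"
  using f by (auto simp: is_chain_map_def)

lemma chain_map_one: "f n \<one>\<^bsub>grp C n\<^esub> = \<one>\<^bsub>grp D n\<^esub>"
  using f chain_complex_comm_group[OF C] chain_complex_comm_group[OF D]
  by (intro hom_one) (auto simp: is_chain_map_def comm_group_def)

lemma chain_map_cycles: "x \<in> carrier (cycles C n) \<Longrightarrow> f n x \<in> carrier (cycles D n)"
  using chain_map_closed chain_map_bd[of x n] chain_map_one[of "n - 1"]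
  by (auto simp: carrier_cycles[OF C] carrier_cycles[OF D])

lemma chain_map_hom_cycles: "f n \<in> hom (cycles C n) (cycles D n)"
proof (rule homI)
  fix x y assume "x \<in> carrier (cycles C n)" "y \<in> carrier (cycles C n)"
  then show "f n (x \<otimes>\<^bsub>cycles C n\<^esub> y) = f n x \<otimes>\<^bsub>cycles D n\<^esub> f n y"
    using f by (simp add: carrier_cycles[OF C] is_chain_map_def hom_mult) (simp add: cycles_def hom_mult)
qed (rule chain_map_cycles)

lemma chain_map_boundaries: "f n ` boundaries C n \<subseteq> boundaries D n"
proof -
  have "f (n + 1 - 1) (bd C (n + 1) x) = bd D (n + 1) (f (n + 1) x)" if "x \<in> carrier (grp C (n + 1))" for x
    by (rule chain_map_bd[OF that])
  then show ?thesis
    using chain_map_closed by (auto simp: boundaries_def)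
qed

lemma homology_map_hom: "homology_map n D f \<in> hom (homology n C) (homology n D)"
  unfolding homology_map_def homology_def
  by (rule quot_map_hom[OF boundaries_normal[OF C] boundaries_normal[OF D]
        chain_map_hom_cycles chain_map_boundaries])

lemma homology_map_coset:
  assumes "x \<in> carrier (cycles C n)"
  shows "homology_map n D f (boundaries C n #>\<^bsub>cycles C n\<^esub> x) = boundaries D n #>\<^bsub>cycles D n\<^esub> f n x"
  unfolding homology_map_def
  by (rule quot_map_coset[OF normal.axioms(2)[OF boundaries_normal[OF C]] boundaries_subgroup[OF C]
        normal.axioms(2)[OF boundaries_normal[OF D]] boundaries_subgroup[OF D]
        chain_map_hom_cycles chain_map_boundaries assms])

end

text \<open>
  In each degree \<open>f\<close> is bijective and compatible with the boundaries, so it matches cycles with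
  cycles and boundaries with boundaries. Injectivity one degree below is used to recognise cycles,
  surjectivity one degree above to recognise boundaries.
\<close>

lemma homology_map_iso:
  assumes C: "is_chain_complex C" and D: "is_chain_complex D" and f: "is_chain_iso C D f"
  shows "homology_map n D f \<in> iso (homology n C) (homology n D)"
proof -
  have map: "is_chain_map C D f" using f by (simp add: is_chain_iso_def)
  have bij: "bij_betw (f m) (carrier (grp C m)) (carrier (grp D m))" for m
    using f by (simp add: is_chain_iso_def iso_def)
  have inj: "x = y" if "x \<in> carrier (grp C m)" "y \<in> carrier (grp C m)" "f m x = f m y" for m x y
    using bij that by (auto simp: bij_betw_def inj_on_def)
  have surj: "\<exists>x\<in>carrier (grp C m). y = f m x" if "y \<in> carrier (grp D m)" for m y
    using bij[of m] that by (auto simp: bij_betw_def)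
  interpret h: group_hom "homology n C" "homology n D" "homology_map n D f"
    using homology_map_hom[OF C D map] comm_group_homology[OF C] comm_group_homology[OF D]
    by (simp add: group_hom_def group_hom_axioms_def comm_group_def)
  have Cg: "group (grp C m)" for m using chain_complex_comm_group[OF C] by (simp add: comm_group_def)
  have Cbd: "bd C m x \<in> carrier (grp C (m - 1))" if "x \<in> carrier (grp C m)" for m x
    using group_hom.hom_closed[OF chain_complex_bd_group_hom[OF C] that] .
  show ?thesis
    unfolding h.iso_iff
  proof (intro conjI ballI impI subsetI)
    fix Y assume "Y \<in> carrier (homology n D)"
    then obtain y where y: "y \<in> carrier (cycles D n)" "Y = boundaries D n #>\<^bsub>cycles D n\<^esub> y"
      by (auto simp: carrier_homology[OF D])
    then have yc: "y \<in> carrier (grp D n)" "bd D n y = \<one>\<^bsub>grp D (n - 1)\<^esub>"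
      by (simp_all add: carrier_cycles[OF D])
    obtain x where x: "x \<in> carrier (grp C n)" "y = f n x" using surj[OF yc(1)] by blast
    have "f (n - 1) (bd C n x) = f (n - 1) \<one>\<^bsub>grp C (n - 1)\<^esub>"
      using yc x chain_map_bd[OF C D map x(1)] chain_map_one[OF C D map, of "n - 1"] by simp
    then have "bd C n x = \<one>\<^bsub>grp C (n - 1)\<^esub>"
      by (rule inj[OF Cbd[OF x(1)] monoid.one_closed[OF group.is_monoid[OF Cg]]])
    then have xz: "x \<in> carrier (cycles C n)" using x by (simp add: carrier_cycles[OF C])
    then have "boundaries C n #>\<^bsub>cycles C n\<^esub> x \<in> carrier (homology n C)"
      by (simp add: carrier_homology[OF C])
    moreover have "Y = homology_map n D f (boundaries C n #>\<^bsub>cycles C n\<^esub> x)"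
      using homology_map_coset[OF C D map xz] y x by simp
    ultimately show "Y \<in> homology_map n D f ` carrier (homology n C)" by blast
  next
    fix S assume "S \<in> carrier (homology n C)" and S1: "homology_map n D f S = \<one>\<^bsub>homology n D\<^esub>"
    then obtain x where x: "x \<in> carrier (cycles C n)" "S = boundaries C n #>\<^bsub>cycles C n\<^esub> x"
      by (auto simp: carrier_homology[OF C])
    have xc: "x \<in> carrier (grp C n)" using x by (simp add: carrier_cycles[OF C])
    have "boundaries D n #>\<^bsub>cycles D n\<^esub> f n x = boundaries D n"
      using S1 homology_map_coset[OF C D map x(1)] x by (simp add: homology_def)
    then have "f n x \<in> boundaries D n"
      using group.rcos_self[OF normal.axioms(2)[OF boundaries_normal[OF D]]
          chain_map_cycles[OF C D map x(1)] boundaries_subgroup[OF D]] by simp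
    then obtain w where w: "w \<in> carrier (grp D (n + 1))" "f n x = bd D (n + 1) w"
      by (auto simp: boundaries_def)
    obtain v where v: "v \<in> carrier (grp C (n + 1))" "w = f (n + 1) v" using surj[OF w(1)] by blast
    have "f (n + 1 - 1) (bd C (n + 1) v) = bd D (n + 1) (f (n + 1) v)"
      by (rule chain_map_bd[OF C D map v(1)])
    then have "f n x = f n (bd C (n + 1) v)" using w v by simp
    moreover have "bd C (n + 1) v \<in> carrier (grp C n)" using Cbd[OF v(1)] by simp
    ultimately have "x = bd C (n + 1) v" using inj[OF xc] by blast
    then have "x \<in> boundaries C n" using v by (auto simp: boundaries_def)
    then have "S = boundaries C n"
      using x group.coset_join2[OF normal.axioms(2)[OF boundaries_normal[OF C]] x(1) boundaries_subgroup[OF C]]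
      by simp
    then show "S = \<one>\<^bsub>homology n C\<^esub>" by (simp add: homology_def)
  qed
qed

lemma ab_functor_homology:
  assumes F: "ch_functor F"
  shows "ab_functor (homology_functor n F)"
proof -
  have C: "is_chain_complex (Ob F e)" if "0 \<le> e" for e using F that by (simp add: ch_functor_def)
  have m: "is_chain_map (Ob F e) (Ob F e') (Ar F e e')" if "0 \<le> e" "e \<le> e'" for e e'
    using F that by (simp add: ch_functor_def)
  have cg: "x \<in> carrier (grp (Ob F e) n)" if "0 \<le> e" "x \<in> carrier (cycles (Ob F e) n)" for e x
    using that by (simp add: carrier_cycles[OF C])
  have id: "homology_map n (Ob F e) (Ar F e e) S = S"
    if e: "0 \<le> e" and S: "S \<in> carrier (homology n (Ob F e))" for e S
  proof -
    obtain x where x: "x \<in> carrier (cycles (Ob F e) n)" "S = boundaries (Ob F e) n #>\<^bsub>cycles (Ob F e) n\<^esub> x"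
      using S by (auto simp: carrier_homology[OF C[OF e]])
    have "Ar F e e n x = x" using F e cg[OF e x(1)] by (simp add: ch_functor_def)
    then show ?thesis using homology_map_coset[OF C[OF e] C[OF e] m[OF e order_refl] x(1)] x(2) by simp
  qed
  have comp: "homology_map n (Ob F e'') (Ar F e' e'') (homology_map n (Ob F e') (Ar F e e') S)
      = homology_map n (Ob F e'') (Ar F e e'') S"
    if e: "0 \<le> e" "e \<le> e'" "e' \<le> e''" and S: "S \<in> carrier (homology n (Ob F e))" for e e' e'' S
  proof -
    have e': "0 \<le> e'" "0 \<le> e''" "e \<le> e''" using e by auto
    obtain x where x: "x \<in> carrier (cycles (Ob F e) n)" "S = boundaries (Ob F e) n #>\<^bsub>cycles (Ob F e) n\<^esub> x"
      using S by (auto simp: carrier_homology[OF C[OF e(1)]])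
    have "Ar F e' e'' n (Ar F e e' n x) = Ar F e e'' n x"
      using F e cg[OF e(1) x(1)] unfolding ch_functor_def by blast
    then show ?thesis
      using homology_map_coset[OF C[OF e(1)] C[OF e'(1)] m[OF e(1,2)] x(1)]
        homology_map_coset[OF C[OF e'(1)] C[OF e'(2)] m[OF e'(1) e(3)]
          chain_map_cycles[OF C[OF e(1)] C[OF e'(1)] m[OF e(1,2)] x(1)]]
        homology_map_coset[OF C[OF e(1)] C[OF e'(2)] m[OF e(1) e'(3)] x(1)]
      by (simp add: x(2))
  qed
  have hom: "homology_map n (Ob F e') (Ar F e e') \<in> hom (homology n (Ob F e)) (homology n (Ob F e'))"
    if "0 \<le> e" "e \<le> e'" for e e'
    using homology_map_hom[OF C C m] that by simp
  show ?thesis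
    using comm_group_homology[OF C] id comp hom by (simp add: ab_functor_def homology_functor_def)
qed

theorem homology_functor_naturally_isomorphic:
  assumes "ch_naturally_isomorphic F G"
  shows "ab_naturally_isomorphic (homology_functor n F) (homology_functor n G)"
proof -
  obtain \<eta> where F: "ch_functor F" and G: "ch_functor G"
    and iso: "\<And>e. 0 \<le> e \<Longrightarrow> is_chain_iso (Ob F e) (Ob G e) (\<eta> e)"
    and nat: "\<And>e e' n x. 0 \<le> e \<Longrightarrow> e \<le> e' \<Longrightarrow> x \<in> carrier (grp (Ob F e) n) \<Longrightarrow>
             \<eta> e' n (Ar F e e' n x) = Ar G e e' n (\<eta> e n x)"
    using assms unfolding ch_naturally_isomorphic_def by blast
  have C: "is_chain_complex (Ob F e)" "is_chain_complex (Ob G e)" if "0 \<le> e" for e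
    using F G that by (simp_all add: ch_functor_def)
  have m: "is_chain_map (Ob F e) (Ob F e') (Ar F e e')" "is_chain_map (Ob G e) (Ob G e') (Ar G e e')"
    if "0 \<le> e" "e \<le> e'" for e e'
    using F G that by (simp_all add: ch_functor_def)
  have im: "is_chain_map (Ob F e) (Ob G e) (\<eta> e)" if "0 \<le> e" for e
    using iso[OF that] by (simp add: is_chain_iso_def)
  have natural: "homology_map n (Ob G e') (\<eta> e') (homology_map n (Ob F e') (Ar F e e') S)
      = homology_map n (Ob G e') (Ar G e e') (homology_map n (Ob G e) (\<eta> e) S)"
    if e: "0 \<le> e" "e \<le> e'" and S: "S \<in> carrier (homology n (Ob F e))" for e e' S
  proof -
    have e': "0 \<le> e'" using e by simp
    obtain x where x: "x \<in> carrier (cycles (Ob F e) n)" "S = boundaries (Ob F e) n #>\<^bsub>cycles (Ob F e) n\<^esub> x"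
      using S by (auto simp: carrier_homology[OF C(1)[OF e(1)]])
    have "x \<in> carrier (grp (Ob F e) n)" using x(1) e by (simp add: carrier_cycles[OF C(1)])
    then have "\<eta> e' n (Ar F e e' n x) = Ar G e e' n (\<eta> e n x)" by (rule nat[OF e])
    then show ?thesis
      using homology_map_coset[OF C(1)[OF e(1)] C(1)[OF e'] m(1)[OF e] x(1)]
        homology_map_coset[OF C(1)[OF e'] C(2)[OF e'] im[OF e']
          chain_map_cycles[OF C(1)[OF e(1)] C(1)[OF e'] m(1)[OF e] x(1)]]
        homology_map_coset[OF C[OF e(1)] im[OF e(1)] x(1)]
        homology_map_coset[OF C(2)[OF e(1)] C(2)[OF e'] m(2)[OF e]
          chain_map_cycles[OF C[OF e(1)] im[OF e(1)] x(1)]]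
      by (simp add: x(2))
  qed
  have "\<forall>e\<ge>0. homology_map n (Ob G e) (\<eta> e) \<in> iso (homology n (Ob F e)) (homology n (Ob G e))"
    using homology_map_iso[OF C iso] by blast
  then show ?thesis
    unfolding ab_naturally_isomorphic_def
    using ab_functor_homology[OF F] ab_functor_homology[OF G] natural
    by (intro conjI exI[of _ "\<lambda>e. homology_map n (Ob G e) (\<eta> e)"]) (simp_all add: homology_functor_def)
qed

section \<open>Chains on a simplicial set\<close>

lemma finprod_free_Abelian_group:
  assumes "finite I" "\<And>i. i \<in> I \<Longrightarrow> f i \<in> carrier (free_Abelian_group S)"
  shows "finprod (free_Abelian_group S) f I = sum f I"
  using assms
proof (induction I rule: finite_induct)
  interpret comm_group "free_Abelian_group S" by (rule abelian_free_Abelian_group)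
  case empty show ?case by simp
next
  interpret comm_group "free_Abelian_group S" by (rule abelian_free_Abelian_group)
  case (insert i I)
  then show ?case by (subst finprod_insert) (auto simp del: carrier_free_Abelian_group_iff)
qed

text \<open>
  The boundary map of the unnormalised complex as a plain sum, without the group record and
  without the case distinction on the sign of the degree.
\<close>

definition face_sum :: "'a sset \<Rightarrow> nat \<Rightarrow> ('a \<Rightarrow>\<^sub>0 int) \<Rightarrow> ('a \<Rightarrow>\<^sub>0 int)" where
  "face_sum S n x = (\<Sum>i\<le>n. frag_cmul ((- 1) ^ i) (frag_extend (frag_of \<circ> face S n i) x))"

lemma face_sum_add: "face_sum S n (x + y) = face_sum S n x + face_sum S n y"
  by (simp add: face_sum_def frag_extend_add frag_cmul_distrib2 sum.distrib)

lemma face_sum_diff: "face_sum S n (x - y) = face_sum S n x - face_sum S n y"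
  using face_sum_add[of S n "x - y" y] by simp

lemma face_sum_0 [simp]: "face_sum S n 0 = 0"
  by (simp add: face_sum_def)

lemma face_sum_sum: "face_sum S n (sum f I) = (\<Sum>i\<in>I. face_sum S n (f i))"
  by (induction I rule: infinite_finite_induct) (simp_all add: face_sum_add)

lemma face_sum_cmul: "face_sum S n (frag_cmul k x) = frag_cmul k (face_sum S n x)"
  by (simp add: face_sum_def frag_extend_cmul frag_cmul_sum mult.commute)

lemma face_sum_frag_of: "face_sum S n (frag_of a) = (\<Sum>i\<le>n. frag_cmul ((- 1) ^ i) (frag_of (face S n i a)))"
  by (simp add: face_sum_def)

text \<open>
  The part of the axioms of a simplicial set on which the complex of chains depends.
\<close>

definition simplicial_faces :: "'a sset \<Rightarrow> bool" where
  "simplicial_faces S \<longleftrightarrow>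
     (\<forall>n i. \<forall>a\<in>simp S (Suc n). i \<le> Suc n \<longrightarrow> face S (Suc n) i a \<in> simp S n) \<and>
     (\<forall>n i j. \<forall>a\<in>simp S (Suc (Suc n)). i < j \<longrightarrow> j \<le> Suc (Suc n) \<longrightarrow>
        face S (Suc n) i (face S (Suc (Suc n)) j a) = face S (Suc n) (j - 1) (face S (Suc (Suc n)) i a))"

text \<open>
  The classical cancellation: by the simplicial identity the term with faces \<open>(i, j)\<close>, \<open>j < i\<close>,
  equals the one with faces \<open>(j, i - 1)\<close>, and the two occur with opposite signs.
\<close>

lemma face_sum_face_sum:
  assumes S: "simplicial_faces S" and x: "Poly_Mapping.keys x \<subseteq> simp S (Suc (Suc n))"
  shows "face_sum S (Suc n) (face_sum S (Suc (Suc n)) x) = 0"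
proof (rule free_Abelian_group_induct[OF x])
  fix a assume a: "a \<in> simp S (Suc (Suc n))"
  let ?m = "Suc (Suc n)"
  let ?t = "\<lambda>(i, j). frag_cmul ((- 1) ^ (i + j)) (frag_of (face S (Suc n) j (face S ?m i a)))"
  let ?L = "{(i, j). j < i \<and> i \<le> ?m}" and ?U = "{(i, j). i \<le> j \<and> j \<le> Suc n}"
  have fin: "finite ?L" "finite ?U"
    by (rule finite_subset[of _ "{..?m} \<times> {..?m}"]; auto)+
  have "face_sum S (Suc n) (face_sum S ?m (frag_of a)) = (\<Sum>i\<le>?m. \<Sum>j\<le>Suc n. ?t (i, j))"
    by (simp add: face_sum_frag_of face_sum_sum face_sum_cmul frag_cmul_sum power_add del: sum.atMost_Suc)
  also have "\<dots> = sum ?t ({..?m} \<times> {..Suc n})"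
    by (simp add: sum.cartesian_product case_prod_unfold del: sum.atMost_Suc)
  also have "{..?m} \<times> {..Suc n} = ?L \<union> ?U" by auto
  also have "sum ?t (?L \<union> ?U) = sum ?t ?L + sum ?t ?U"
    by (rule sum.union_disjoint[OF fin]) auto
  also have "sum ?t ?L = (\<Sum>p\<in>?U. - ?t p)"
  proof (rule sum.reindex_bij_witness[of _ "\<lambda>(i, j). (Suc j, i)" "\<lambda>(i, j). (j, i - 1)"])
    fix p assume "p \<in> ?L"
    then obtain i j where p: "p = (Suc i, j)" and ij: "j \<le> i" "i \<le> Suc n"
      by (cases p; cases "fst p") auto
    have "face S (Suc n) j (face S ?m (Suc i) a) = face S (Suc n) i (face S ?m j a)"
      using S a ij by (auto simp: simplicial_faces_def)
    then show "- ?t (case p of (i, j) \<Rightarrow> (j, i - 1)) = ?t p"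
      by (simp add: p add.commute)
  qed auto
  finally show "face_sum S (Suc n) (face_sum S ?m (frag_of a)) = 0"
    by (simp add: sum_negf)
qed (simp_all add: face_sum_diff)

lemma face_sum_closed:
  assumes S: "simplicial_faces S" and x: "Poly_Mapping.keys x \<subseteq> simp S (Suc n)" and i: "i \<le> Suc n"
  shows "Poly_Mapping.keys (frag_extend (frag_of \<circ> face S (Suc n) i) x) \<subseteq> simp S n"
  using keys_frag_extend[of "frag_of \<circ> face S (Suc n) i" x] S x i
  by (fastforce simp: simplicial_faces_def)

lemma grp_unnormalised:
  "grp (unnormalised (free_sab S)) n = (if 0 \<le> n then free_Abelian_group (simp S (nat n)) else singleton_group 0)"
  by (simp add: unnormalised_def free_sab_def)

lemma bd_unnormalised_nonpos: "n \<le> 0 \<Longrightarrow> bd (unnormalised (free_sab S)) n x = 0"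
  by (simp add: unnormalised_def free_sab_def)

lemma bd_unnormalised_Suc:
  assumes S: "simplicial_faces S" and x: "Poly_Mapping.keys x \<subseteq> simp S (Suc n)"
  shows "bd (unnormalised (free_sab S)) (int (Suc n)) x = face_sum S (Suc n) x"
proof -
  have "bd (unnormalised (free_sab S)) (int (Suc n)) x = finprod (free_Abelian_group (simp S n))
      (\<lambda>i. frag_extend (frag_of \<circ> face S (Suc n) i) x [^]\<^bsub>free_Abelian_group (simp S n)\<^esub> ((- 1) ^ i :: int)) {..Suc n}"
    by (simp add: unnormalised_def free_sab_def nat_add_distrib del: of_nat_Suc)
  also have "\<dots> = (\<Sum>i\<le>Suc n. frag_extend (frag_of \<circ> face S (Suc n) i) x
      [^]\<^bsub>free_Abelian_group (simp S n)\<^esub> ((- 1) ^ i :: int))"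
    by (rule finprod_free_Abelian_group)
       (use face_sum_closed[OF S x] in \<open>auto intro!: group.int_pow_closed\<close>)
  also have "\<dots> = face_sum S (Suc n) x"
    unfolding face_sum_def
    by (rule sum.cong[OF refl], rule int_pow_free_Abelian_group, rule face_sum_closed[OF S x]) simp
  finally show ?thesis .
qed

lemma keys_face_sum:
  assumes S: "simplicial_faces S" and x: "Poly_Mapping.keys x \<subseteq> simp S (Suc n)"
  shows "Poly_Mapping.keys (face_sum S (Suc n) x) \<subseteq> simp S n"
proof -
  have "face_sum S (Suc n) x \<in> carrier (free_Abelian_group (simp S n))"
    unfolding face_sum_def
    by (rule sum_closed_free_Abelian_group) (use face_sum_closed[OF S x] keys_cmul in fastforce)
  then show ?thesis by simp
qed

lemma int_pos_cases:
  fixes n :: int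
  obtains "n \<le> 0" | m where "n = int (Suc m)"
proof (cases "n \<le> 0")
  case False
  then have "n = int (Suc (nat (n - 1)))" by simp
  then show ?thesis using that by blast
qed (use that in blast)

lemma is_chain_complex_unnormalised:
  assumes S: "simplicial_faces S"
  shows "is_chain_complex (unnormalised (free_sab S))"
  unfolding is_chain_complex_def
proof (intro conjI allI ballI)
  let ?C = "unnormalised (free_sab S)"
  fix n
  show "comm_group (grp ?C n)" by (simp add: grp_unnormalised abelian_free_Abelian_group)
  show "bd ?C n \<in> hom (grp ?C n) (grp ?C (n - 1))"
  proof (cases n rule: int_pos_cases)
    case 1
    then show ?thesis
      by (auto simp: hom_def grp_unnormalised bd_unnormalised_nonpos singleton_group_def)
  next
    case (2 m)
    show ?thesis
    proof (rule homI)
      fix x assume "x \<in> carrier (grp ?C n)"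
      then have x: "Poly_Mapping.keys x \<subseteq> simp S (Suc m)" by (simp add: 2 grp_unnormalised nat_add_distrib)
      show "bd ?C n x \<in> carrier (grp ?C (n - 1))"
        using keys_face_sum[OF S x] bd_unnormalised_Suc[OF S x] 2 by (simp add: grp_unnormalised)
      fix y assume "y \<in> carrier (grp ?C n)"
      then have y: "Poly_Mapping.keys y \<subseteq> simp S (Suc m)" by (simp add: 2 grp_unnormalised nat_add_distrib)
      have xy: "Poly_Mapping.keys (x + y) \<subseteq> simp S (Suc m)" using x y keys_add[of x y] by blast
      show "bd ?C n (x \<otimes>\<^bsub>grp ?C n\<^esub> y) = bd ?C n x \<otimes>\<^bsub>grp ?C (n - 1)\<^esub> bd ?C n y"
        using bd_unnormalised_Suc[OF S x] bd_unnormalised_Suc[OF S y] bd_unnormalised_Suc[OF S xy] 2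
        by (simp add: grp_unnormalised face_sum_add)
    qed
  qed
  fix x assume x: "x \<in> carrier (grp ?C n)"
  have one: "\<one>\<^bsub>grp ?C (n - 2)\<^esub> = 0" by (simp add: grp_unnormalised singleton_group_def)
  show "bd ?C (n - 1) (bd ?C n x) = \<one>\<^bsub>grp ?C (n - 2)\<^esub>"
  proof (cases "n - 1" rule: int_pos_cases)
    case 1
    then show ?thesis by (simp add: one bd_unnormalised_nonpos)
  next
    case (2 m)
    then have n: "n = int (Suc (Suc m))" by simp
    have x': "Poly_Mapping.keys x \<subseteq> simp S (Suc (Suc m))"
      using x by (simp add: n grp_unnormalised nat_add_distrib)
    show ?thesis
      unfolding one 2 unfolding n bd_unnormalised_Suc[OF S x'] bd_unnormalised_Suc[OF S keys_face_sum[OF S x']]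
      by (rule face_sum_face_sum[OF S x'])
  qed
qed

section \<open>The enriched nerve\<close>

fun path_length :: "('x \<Rightarrow> 'x \<Rightarrow> real) \<Rightarrow> 'x list \<Rightarrow> real" where
  "path_length d (x # y # zs) = d x y + path_length d (y # zs)"
| "path_length d _ = 0"

lemma path_length_eq_sum: "length xs = Suc n \<Longrightarrow> (\<Sum>i<n. d (xs ! i) (xs ! Suc i)) = path_length d xs"
proof (induction d xs arbitrary: n rule: path_length.induct)
  case (1 d x y zs)
  then obtain m where "n = Suc m" by (cases n) auto
  then show ?case using 1 by (simp add: sum.lessThan_Suc_shift del: sum.lessThan_Suc)
qed auto

abbreviation (input) delete_nth :: "nat \<Rightarrow> 'a list \<Rightarrow> 'a list" where
  "delete_nth i xs \<equiv> take i xs @ drop (Suc i) xs"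

text \<open>
  Deleting an end point drops a non-negative summand; deleting an inner point replaces two summands by
  one and uses the triangle inequality. This is why the enriched nerve is closed under faces.
\<close>

lemma path_length_delete_nth:
  assumes "Metric_space X d" "set xs \<subseteq> X"
  shows "path_length d (delete_nth i xs) \<le> path_length d xs"
  using assms
proof (induction d xs arbitrary: i rule: path_length.induct)
  case (1 d x y zs)
  interpret Metric_space X d by fact
  consider "i = 0" | "i = Suc 0" | j where "i = Suc (Suc j)" by (metis not0_implies_Suc)
  then show ?case
  proof cases
    case 2
    then show ?thesis using 1 triangle[of x y] by (cases zs) auto
  next
    case (3 j)
    then show ?thesis using 1(1)[of "Suc j"] 1(2,3) by simp
  qed simp
next
  case ("2_2" d v)
  then show ?case by (cases i) auto
qed simp

lemma delete_nth_delete_nth: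
  "i < j \<Longrightarrow> delete_nth i (delete_nth j xs) = delete_nth (j - 1) (delete_nth i xs)"
  by (induction xs arbitrary: i j) (auto simp: take_Cons drop_Cons split: nat.splits)

lemma simplicial_faces_nerve:
  assumes "Metric_space X d"
  shows "simplicial_faces (nerve_at X d e)"
  unfolding simplicial_faces_def
proof (intro conjI allI ballI impI)
  fix n i xs assume xs: "xs \<in> simp (nerve_at X d e) (Suc n)" and i: "i \<le> Suc n"
  have l: "length xs = Suc (Suc n)" "length (delete_nth i xs) = Suc n" using xs i by (auto simp: nerve_at_def)
  have s: "set xs \<subseteq> X" "set (delete_nth i xs) \<subseteq> X"
    using xs set_take_subset[of i xs] set_drop_subset[of "Suc i" xs] by (auto simp: nerve_at_def)
  have "path_length d xs \<le> e"
    using xs path_length_eq_sum[OF l(1), of d] by (simp add: nerve_at_def)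
  then have "path_length d (delete_nth i xs) \<le> e"
    using path_length_delete_nth[OF assms s(1), of i] by simp
  then show "face (nerve_at X d e) (Suc n) i xs \<in> simp (nerve_at X d e) n"
    using l s path_length_eq_sum[OF l(2), of d] by (simp add: nerve_at_def)
next
  fix n i j xs assume "i < (j::nat)"
  then show "face (nerve_at X d e) (Suc n) i (face (nerve_at X d e) (Suc (Suc n)) j xs)
      = face (nerve_at X d e) (Suc n) (j - 1) (face (nerve_at X d e) (Suc (Suc n)) i xs)"
    using delete_nth_delete_nth[of i j xs] by (simp add: nerve_at_def)
qed

text \<open>
  For \<open>e \<le> e'\<close> the simplices at \<open>e\<close> are among those at \<open>e'\<close> and the face maps are given by the
  same formula, so the induced maps are inclusions and all functor laws are immediate.
\<close>

theorem ch_functor_CN: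
  assumes "Metric_space X d"
  shows "ch_functor (CN X d)"
proof -
  let ?N = "nerve_at X d"
  have S: "simplicial_faces (?N e)" for e by (rule simplicial_faces_nerve[OF assms])
  have Ob: "Ob (CN X d) e = unnormalised (free_sab (?N e))" for e
    by (simp add: CN_def enriched_nerve_def)
  have Ar: "Ar (CN X d) e e' n x = (if 0 \<le> n then x else 0)" for e e' n x
    by (simp add: CN_def enriched_nerve_def unnormalised_map_def free_sab_map_def free_sab_def o_def
        flip: frag_expansion)
  have mono: "simp (?N e) n \<subseteq> simp (?N e') n" if "e \<le> e'" for e e' n
    using that by (auto simp: nerve_at_def)
  have Ar_id: "Ar (CN X d) e e' n x = x" if "x \<in> carrier (grp (Ob (CN X d) e) n)" for e e' n x
    using that by (auto simp: Ar Ob grp_unnormalised split: if_splits)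
  have carr: "x \<in> carrier (grp (Ob (CN X d) e') n)"
    if "x \<in> carrier (grp (Ob (CN X d) e) n)" "e \<le> e'" for e e' n x
    using that(1) mono[OF that(2), of "nat n"] by (cases "0 \<le> n") (auto simp: Ob grp_unnormalised)
  have bd: "bd (Ob (CN X d) e') n x = bd (Ob (CN X d) e) n x"
    if "x \<in> carrier (grp (Ob (CN X d) e) n)" "e \<le> e'" for e e' n x
  proof (cases n rule: int_pos_cases)
    case 1
    then show ?thesis by (simp add: Ob bd_unnormalised_nonpos)
  next
    case (2 m)
    then have x: "Poly_Mapping.keys x \<subseteq> simp (?N e) (Suc m)"
      using that by (simp add: Ob grp_unnormalised nat_add_distrib)
    then show ?thesis
      unfolding 2 Ob bd_unnormalised_Suc[OF S x] bd_unnormalised_Suc[OF S order_trans[OF x mono[OF that(2)]]]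
      by (simp add: face_sum_def nerve_at_def)
  qed
  have cpx: "is_chain_complex (Ob (CN X d) e)" for e
    unfolding Ob by (rule is_chain_complex_unnormalised[OF S])
  have bdc: "bd (Ob (CN X d) e) n x \<in> carrier (grp (Ob (CN X d) e) (n - 1))"
    if "x \<in> carrier (grp (Ob (CN X d) e) n)" for e n x
    using cpx[of e] that by (auto simp: is_chain_complex_def hom_def)
  have mc: "x \<otimes>\<^bsub>grp (Ob (CN X d) e) n\<^esub> y \<in> carrier (grp (Ob (CN X d) e) n)"
    if "x \<in> carrier (grp (Ob (CN X d) e) n)" "y \<in> carrier (grp (Ob (CN X d) e) n)" for e n x y
    using cpx[of e] that
    by (auto simp: is_chain_complex_def comm_group_def group.is_monoid monoid.m_closed)
  have "is_chain_map (Ob (CN X d) e) (Ob (CN X d) e') (Ar (CN X d) e e')" if "e \<le> e'" for e e'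
    unfolding is_chain_map_def
  proof (intro conjI allI ballI)
    fix n
    have mult: "x \<otimes>\<^bsub>grp (Ob (CN X d) e') n\<^esub> y = x \<otimes>\<^bsub>grp (Ob (CN X d) e) n\<^esub> y" for x y
      by (simp add: Ob grp_unnormalised)
    show "Ar (CN X d) e e' n \<in> hom (grp (Ob (CN X d) e) n) (grp (Ob (CN X d) e') n)"
      by (rule homI) (use that carr in \<open>simp_all add: Ar_id mc mult\<close>)
    fix x assume x: "x \<in> carrier (grp (Ob (CN X d) e) n)"
    show "Ar (CN X d) e e' (n - 1) (bd (Ob (CN X d) e) n x) = bd (Ob (CN X d) e') n (Ar (CN X d) e e' n x)"
      by (simp add: Ar_id[OF x] Ar_id[OF bdc[OF x]] bd[OF x that])
  qed
  then show ?thesis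
    unfolding ch_functor_def using cpx carr by (auto simp: Ar_id)
qed

section \<open>Blurred magnitude homology is persistent homology\<close>

theorem theorem29:
  fixes X :: "'x set" and d :: "'x \<Rightarrow> 'x \<Rightarrow> real"
  assumes "Metric_space X d"
  shows "ch_naturally_isomorphic (CN_coend X d) (CN X d) \<and>
         (\<forall>n::int. ab_naturally_isomorphic
            (blurred_magnitude_homology X d n) (persistent_homology X d n))"
proof -
  have "ch_naturally_isomorphic (CN_coend X d) (CN X d)"
    using coend_coeff_naturally_isomorphic[OF ch_functor_CN[OF assms]] by (simp add: CN_coend_def)
  then show ?thesis
    by (simp add: blurred_magnitude_homology_def persistent_homology_def
        homology_functor_naturally_isomorphic)
qed

end
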